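(* Consider the fully discrete interface model on $\mathbf{Z}$ described in the context, with driving force $F=\frac12$ and obstacle field $Q_{i,j}$ ($i\in\mathbf{Z}$, $j\in\mathbf{N}_0$) built from independent copies, one for each row $j$, of a stationary discrete renewal point process with gap distribution $G$, where $G$ is the law of an $\mathbf{N}$-valued random variable $Y$ with $\mathbf{E}Y<\infty$. (a) For every such $G$, almost surely there is no non-negative stationary solution, i.e. no $w:\mathbf{Z}\to\mathbf{N}_0$ with $S(\Delta_1 w_i-Q_{i,w_i}+F)=0$ for all $i\in\mathbf{Z}$; moreover, almost surely, $\liminf_{k\to\infty}u_i(k)=+\infty$ for every $i\in\mathbf{Z}$. (b) There exists such a $G$ for which $$\limsup_{n\to\infty}\frac{u_0(n)}{n}=0\qquad\text{almost surely.}$$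
   Context: $\mathbf{N}=\{1,2,\dots\}$, $\mathbf{N}_0=\{0,1,2,\dots\}$. The one-dimensional discrete Laplacian is $\Delta_1 u_i=u_{i+1}+u_{i-1}-2u_i$. The evolution law $S:\mathbf{R}\to\{0,1\}$ is $S(a)=1$ if $a>0$ and $S(a)=0$ otherwise. Given an obstacle field $Q_{i,j}(\omega)\in\{0,1\}$, $i\in\mathbf{Z}$, $j\in\mathbf{N}_0$, the interface height $u_i(k)\in\mathbf{N}_0$ at discrete times $k\in\mathbf{N}_0$ is defined by $u_i(0)=0$ and $$u_i(k+1,\omega)-u_i(k,\omega)=S\big(\Delta_1 u_i(k,\omega)-Q_{i,u_i(k,\omega)}(\omega)+F\big),\qquad i\in\mathbf{Z}.$$ Obstacle field: a stationary discrete renewal point process with gap distribution $G$ is a random subset of $\mathbf{Z}$ whose law is invariant under integer shifts and for which, conditionally on $0$ being a point, the successive gaps between consecutive points are independent with law $G$ (it exists since $G$ has finite mean). For each row $j\in\mathbf{N}_0$ an independent copy of this process is taken; $Q_{i,j}=0$ if $i$ is a point of the process in row $j$ (no obstacle at $(i,j)$), and $Q_{i,j}=1$ (an obstacle of size 1) if $i$ is not a point of it. *)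

theory Defs
  imports "HOL-Probability.Probability" "HOL-Library.Extended_Nat"
begin

section \<open>Interface dynamics\<close>

definition discrete_laplacian :: "(int \<Rightarrow> nat) \<Rightarrow> int \<Rightarrow> int" where
  "discrete_laplacian u i = int (u (i + 1)) + int (u (i - 1)) - 2 * int (u i)"

definition evolution_law :: "real \<Rightarrow> nat" where
  "evolution_law a = (if a > 0 then 1 else 0)"

definition velocity :: "real \<Rightarrow> (int \<Rightarrow> nat \<Rightarrow> nat) \<Rightarrow> (int \<Rightarrow> nat) \<Rightarrow> int \<Rightarrow> nat" where
  "velocity F q u i =
     evolution_law (real_of_int (discrete_laplacian u i) - real (q i (u i)) + F)"

primrec interface :: "real \<Rightarrow> (int \<Rightarrow> nat \<Rightarrow> nat) \<Rightarrow> nat \<Rightarrow> int \<Rightarrow> nat" where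
  "interface F q 0 = (\<lambda>i. 0)"
| "interface F q (Suc k) = (\<lambda>i. interface F q k i + velocity F q (interface F q k) i)"

text \<open>Heights are of type \<^typ>\<open>nat\<close>, so non-negativity is built in.\<close>

definition stationary_solution ::
    "real \<Rightarrow> (int \<Rightarrow> nat \<Rightarrow> nat) \<Rightarrow> (int \<Rightarrow> nat) \<Rightarrow> bool" where
  "stationary_solution F q w \<longleftrightarrow> (\<forall>i. velocity F q w i = 0)"

section \<open>Stationary discrete renewal processes\<close>

definition point_configs :: "int set measure" where
  "point_configs = sigma UNIV (range (\<lambda>i. {A. i \<in> A}))"

definition gap_distribution :: "nat pmf \<Rightarrow> bool" where
  "gap_distribution G \<longleftrightarrow> 0 \<notin> set_pmf G \<and> integrable (measure_pmf G) real"

text \<open>The increasing enumeration of \<open>A\<close> by the integers that starts at \<open>0\<close>. It exists (and is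
  unique) if \<open>0 \<in> A\<close> and \<open>A\<close> is unbounded in both directions; otherwise it is a junk value.\<close>

definition point_enum :: "int set \<Rightarrow> int \<Rightarrow> int" where
  "point_enum A = (THE T. strict_mono T \<and> range T = A \<and> T 0 = 0)"

definition gap :: "int \<Rightarrow> int set \<Rightarrow> nat" where
  "gap n A = nat (point_enum A (n + 1) - point_enum A n)"

text \<open>The second condition says that the process almost surely consists of a bi-infinite sequence
  of points. It is needed: invariance and the conditional law alone would also allow the
  empty configuration to occur with positive probability. Together with shift invariance it implies
  that the event \<open>0 \<in> X\<close> on which one conditions has positive probability.\<close>

definition stationary_renewal_process ::
    "'w measure \<Rightarrow> nat pmf \<Rightarrow> ('w \<Rightarrow> int set) \<Rightarrow> bool" where
  "stationary_renewal_process M G X \<longleftrightarrow>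
     X \<in> measurable M point_configs \<and>
     (AE \<omega> in M. \<forall>m. (\<exists>i\<in>X \<omega>. i < m) \<and> (\<exists>i\<in>X \<omega>. m < i)) \<and>
     (\<forall>s. distr M point_configs (\<lambda>\<omega>. (\<lambda>i. i + s) ` X \<omega>) = distr M point_configs X) \<and>
     (let M\<^sub>0 = uniform_measure M {\<omega> \<in> space M. 0 \<in> X \<omega>} in
       prob_space.indep_vars M\<^sub>0 (\<lambda>_. count_space UNIV) (\<lambda>n \<omega>. gap n (X \<omega>)) (UNIV :: int set) \<and>
       (\<forall>n. distr M\<^sub>0 (count_space UNIV) (\<lambda>\<omega>. gap n (X \<omega>)) = measure_pmf G))"

definition obstacle_field ::
    "'w measure \<Rightarrow> nat pmf \<Rightarrow> ('w \<Rightarrow> int \<Rightarrow> nat \<Rightarrow> nat) \<Rightarrow> bool" where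
  "obstacle_field M G Q \<longleftrightarrow>
     prob_space M \<and>
     (\<exists>X. (\<forall>j. stationary_renewal_process M G (X j)) \<and>
          prob_space.indep_vars M (\<lambda>_. point_configs) X (UNIV :: nat set) \<and>
          (\<forall>\<omega> i j. Q \<omega> i j = (if i \<in> X j \<omega> then 0 else 1)))"

end

theory Submission
  imports Defs
begin

text \<open>
  Part (a) is deterministic once every row has an obstacle-free site, which holds almost surely. With
  driving force \<open>1/2\<close>, a site moves iff its Laplacian is at least the size of the obstacle at its
  current height. A stationary profile is therefore concave; being non-negative on all of
  \<open>\<int>\<close> it is constant, and the free sites of its row contradict stationarity
  (\<open>no_stationary_solution\<close>). An interface that stays bounded at one site stays bounded at its
  neighbours, hence everywhere, and would converge to a stationary profile
  (\<open>interface_unbounded\<close>).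

  Part (b) rests on one observation: if some row \<open>j\<close> has no free site in \<open>[-R, R]\<close>, then the interface
  at \<open>0\<close> has height at most \<open>j\<close> up to time \<open>R\<close>, because row \<open>j\<close> can be passed only by an
  influence from outside the window, which travels at speed one
  (\<open>interface_le_blocked_row\<close>). It thus suffices to choose \<open>G\<close> such that wide voids are
  frequent. The probability of a void of length \<open>m\<close> is the intensity times
  \<open>\<Sum>s. P(Y > s + m)\<close> (\<open>emeasure_void\<close>). For a gap that equals
  \<open>4 ^ k\<close> with probability of order \<open>8 ^ - k\<close>, the mean is finite, but a window of radius
  \<open>4 ^ k\<close> is void with probability of order \<open>2 ^ - k\<close>. Among \<open>3 ^ k\<close> independent rows there
  is, by Borel-Cantelli, almost surely one with such a void for all large \<open>k\<close>
  (\<open>heavy_some_row_void\<close>), so that the height at time \<open>4 ^ k\<close> is at most \<open>3 ^ k\<close>. Monotonicity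
  in time interpolates between these times.

  That an obstacle field with this gap distribution exists is shown by constructing the stationary
  renewal process for an arbitrary integrable gap law, by Palm inversion: the cell at the
  origin is size-biased and the origin is placed uniformly in it (\<open>law_shift\<close>,
  \<open>palm_law\<close>). Rows are then coordinates of a countable product.
\<close>

section \<open>The dynamics for a fixed obstacle field\<close>

lemma velocity_half:
  "velocity (1/2) q u i = (if int (q i (u i)) \<le> discrete_laplacian u i then 1 else 0)"
proof -
  have "(0 < real_of_int (discrete_laplacian u i) - real (q i (u i)) + 1/2)
      = (int (q i (u i)) \<le> discrete_laplacian u i)"
    by linarith
  then show ?thesis by (simp add: velocity_def evolution_law_def)
qed

text \<open>If some increment of \<open>w\<close> is non-zero, monotonicity of the increments propagates it in the
  direction in which \<open>w\<close> decreases, and \<open>w\<close> falls below zero there.\<close>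

lemma concave_nonneg_const:
  fixes w :: "int \<Rightarrow> nat"
  assumes concave: "\<And>i. discrete_laplacian w i \<le> 0"
  shows "w i = w 0"
proof -
  define d where "d i = int (w (i + 1)) - int (w i)" for i
  have d_Suc: "d (i + 1) \<le> d i" for i
    using concave[of "i + 1"] by (simp add: d_def discrete_laplacian_def)
  have d_right: "d (i + int n) \<le> d i" for i n
  proof (induction n)
    case (Suc n)
    then show ?case using d_Suc[of "i + int n"] by (simp add: algebra_simps)
  qed simp
  have d_zero: "d i = 0" for i
  proof (rule ccontr)
    assume "d i \<noteq> 0"
    then consider "d i \<le> -1" | "d i \<ge> 1" by linarith
    then show False
    proof cases
      case 1
      have "int (w (i + int n)) \<le> int (w i) - int n" for n
      proof (induction n)
        case (Suc n)
        then show ?case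
          using 1 d_right[of i n] by (simp add: d_def algebra_simps)
      qed simp
      from this[of "Suc (w i)"] show False by simp
    next
      case 2
      have "int (w (i + 1 - int n)) \<le> int (w (i + 1)) - int n" for n
      proof (induction n)
        case (Suc n)
        then show ?case
          using 2 d_right[of "i - int n" n] by (simp add: d_def algebra_simps)
      qed simp
      from this[of "Suc (w (i + 1))"] show False by simp
    qed
  qed
  show ?thesis
  proof (induction i rule: int_induct[where k = 0])
    case (step1 i)
    then show ?case using d_zero[of i] by (simp add: d_def)
  next
    case (step2 i)
    then show ?case using d_zero[of "i - 1"] by (simp add: d_def)
  qed simp
qed

text \<open>With \<open>F = 1/2\<close> and obstacles of size at most one, a site is at rest only if the Laplacian is
  non-positive, so \<open>w\<close> is constant; on a flat profile every obstacle-free site of its row moves.\<close>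

lemma no_stationary_solution:
  assumes le1: "\<And>i j. q i j \<le> 1" and free: "\<And>j. \<exists>i. q i j = 0"
  shows "\<not> stationary_solution (1/2) q w"
proof
  assume "stationary_solution (1/2) q w"
  then have st: "discrete_laplacian w i < int (q i (w i))" for i
    unfolding stationary_solution_def velocity_half by (metis not_less zero_neq_one)
  have "discrete_laplacian w i \<le> 0" for i
    using st[of i] le1[of i "w i"] by linarith
  then have const: "w i = w 0" for i by (rule concave_nonneg_const)
  obtain i where "q i (w 0) = 0" using free by blast
  with st[of i] const[of i] const[of "i + 1"] const[of "i - 1"] show False
    by (simp add: discrete_laplacian_def)
qed

lemma interface_mono: "k \<le> l \<Longrightarrow> interface F q k i \<le> interface F q l i"
  by (induction l rule: dec_induct) auto

lemma bounded_incseq_nat_stops: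
  fixes f :: "nat \<Rightarrow> nat"
  assumes mono: "\<And>k l. k \<le> l \<Longrightarrow> f k \<le> f l" and bdd: "\<And>k. f k \<le> B"
  shows "\<exists>K. \<forall>k\<ge>K. f k = f K"
proof -
  have "finite (range f)" using bdd by (intro finite_subset[OF _ finite_atMost[of B]]) auto
  then have "Max (range f) \<in> range f" by (intro Max_in) auto
  then obtain K where "f K = Max (range f)" by auto
  then have "f k \<le> f K" for k using \<open>finite (range f)\<close> by (metis Max_ge rangeI)
  then show ?thesis using mono by (metis le_antisym)
qed

text \<open>After site \<open>i\<close> has stopped, its Laplacian stays non-positive, so the heights of its two
  neighbours add up to at most twice its final height. Boundedness thus spreads along the line.\<close>

lemma bounded_neighbour:
  assumes le1: "\<And>i j. q i j \<le> 1" and bdd: "\<And>k. interface (1/2) q k i \<le> B"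
    and e: "e = 1 \<or> e = -1"
  shows "\<exists>B'. \<forall>k. interface (1/2) q k (i + e) \<le> B'"
proof -
  let ?u = "interface (1/2) q"
  obtain K where K: "?u k i = ?u K i" if "k \<ge> K" for k
    using bounded_incseq_nat_stops[of "\<lambda>k. ?u k i" B] interface_mono bdd by blast
  have "?u k (i + e) \<le> 2 * ?u K i" if "k \<ge> K" for k
  proof -
    have "velocity (1/2) q (?u k) i = 0"
      using K[of k] K[of "Suc k"] that by simp
    then have "discrete_laplacian (?u k) i \<le> 0"
      using le1[of i "?u k i"] by (auto simp: velocity_half split: if_splits)
    then show ?thesis
      using K[OF that] e by (auto simp: discrete_laplacian_def)
  qed
  then have "?u k (i + e) \<le> 2 * ?u K i" for k
    using interface_mono[of k "max k K" "1/2" q "i + e"] by (meson le_trans max.cobounded1 max.cobounded2)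
  then show ?thesis by blast
qed

text \<open>Were the interface bounded at one site, it would be bounded at all sites and hence eventually
  constant at each of them; the limiting profile would be a stationary solution.\<close>

lemma interface_unbounded:
  assumes le1: "\<And>i j. q i j \<le> 1" and free: "\<And>j. \<exists>i. q i j = 0"
  shows "\<exists>k. B < interface (1/2) q k i"
proof (rule ccontr)
  let ?u = "interface (1/2) q"
  assume unreached: "\<not> (\<exists>k. B < ?u k i)"
  have "?u k i \<le> B" for k
  proof (rule leI)
    show "\<not> B < ?u k i" using unreached by blast
  qed
  then have base: "\<exists>B. \<forall>k. ?u k i \<le> B" by blast
  have bdd: "\<exists>B. \<forall>k. ?u k l \<le> B" for l
  proof (induction l rule: int_induct[where k = i])
    case (step1 l)
    then obtain B where "?u k l \<le> B" for k by blast
    with bounded_neighbour[of q l B 1] le1 show ?case by simp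
  next
    case (step2 l)
    then obtain B where "?u k l \<le> B" for k by blast
    with bounded_neighbour[of q l B "-1"] le1 show ?case by simp
  qed (fact base)
  have "\<exists>K. \<forall>k\<ge>K. ?u k l = ?u K l" for l
  proof -
    obtain B where "?u k l \<le> B" for k using bdd by blast
    then show ?thesis by (intro bounded_incseq_nat_stops interface_mono)
  qed
  then obtain K where K: "\<forall>l. \<forall>k\<ge>K l. ?u k l = ?u (K l) l" by metis
  define w where "w l = ?u (K l) l" for l
  have "velocity (1/2) q w l = 0" for l
  proof -
    define k where "k = max (K l) (max (K (l + 1)) (K (l - 1)))"
    have "?u k l = w l" "?u k (l + 1) = w (l + 1)" "?u k (l - 1) = w (l - 1)"
        "?u (Suc k) l = w l"
      unfolding w_def by (rule K[rule_format]; simp add: k_def)+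
    then show ?thesis by (simp add: velocity_def discrete_laplacian_def)
  qed
  then have "stationary_solution (1/2) q w" by (simp add: stationary_solution_def)
  with no_stationary_solution[of q w, OF le1 free] show False by blast
qed

lemma interface_liminf:
  assumes le1: "\<And>i j. q i j \<le> 1" and free: "\<And>j. \<exists>i. q i j = 0"
  shows "liminf (\<lambda>k. enat (interface (1/2) q k i)) = \<infinity>"
proof -
  let ?u = "\<lambda>k. interface (1/2) q k i"
  have "\<forall>\<^sub>F k in sequentially. y < enat (?u k)" if fin: "y < \<infinity>" for y
  proof -
    obtain B where B: "y = enat B" by (cases y) (use fin in auto)
    obtain K where K: "B < ?u K" using interface_unbounded[of q B i, OF le1 free] by blast
    have "B < ?u k" if "k \<ge> K" for k
      using K interface_mono[OF that] by (rule less_le_trans)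
    then show ?thesis
      unfolding eventually_sequentially B enat_ord_simps by blast
  qed
  then have "\<infinity> \<le> liminf (\<lambda>k. enat (?u k))" unfolding le_Liminf_iff by blast
  then show ?thesis by simp
qed

text \<open>A row without obstacle-free sites can be passed only with the help of a neighbour that is
  already above it. Such help can enter the window of radius \<open>R\<close> only through its ends and
  advances by at most one site per step, so inside the light cone of the window it has not arrived.\<close>

lemma interface_le_blocked_row:
  assumes blocked: "\<And>i. \<bar>i\<bar> \<le> int R \<Longrightarrow> q i j = 1"
  shows "k \<le> R \<Longrightarrow> \<bar>i\<bar> \<le> int (R - k) \<Longrightarrow> interface (1/2) q k i \<le> j"
proof (induction k arbitrary: i)
  case (Suc k)
  let ?u = "interface (1/2) q k"
  have le: "?u l \<le> j" if "\<bar>l - i\<bar> \<le> 1" for l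
    using Suc.prems that by (intro Suc.IH) auto
  show ?case
  proof (cases "?u i = j")
    case True
    have "discrete_laplacian ?u i \<le> 0"
      using le[of "i + 1"] le[of "i - 1"] True by (simp add: discrete_laplacian_def)
    moreover have "q i (?u i) = 1" using Suc.prems True by (simp add: blocked)
    ultimately show ?thesis using True by (simp add: velocity_half)
  next
    case False
    then show ?thesis using le[of i] by (simp add: velocity_half)
  qed
qed simp

section \<open>Enumerating bi-infinite sets of integers\<close>

definition biinfinite :: "int set \<Rightarrow> bool" where
  "biinfinite A \<longleftrightarrow> (\<forall>m. (\<exists>i\<in>A. i < m) \<and> (\<exists>i\<in>A. m < i))"

lemma biinfinite_shift:
  assumes "biinfinite A"
  shows "biinfinite ((\<lambda>i. i + s) ` A)"
  unfolding biinfinite_def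
proof (intro allI conjI)
  fix m
  obtain i j where "i \<in> A" "i < m - s" "j \<in> A" "m - s < j"
    using assms unfolding biinfinite_def by blast
  then show "\<exists>i\<in>(\<lambda>i. i + s) ` A. i < m" "\<exists>i\<in>(\<lambda>i. i + s) ` A. m < i"
    by (auto simp: less_diff_eq diff_less_eq)
qed

definition enumerates :: "(int \<Rightarrow> int) \<Rightarrow> int set \<Rightarrow> bool" where
  "enumerates T A \<longleftrightarrow> strict_mono T \<and> range T = A \<and> T 0 = 0"

text \<open>This characterises the neighbouring values of an enumeration by first-order conditions on \<open>A\<close>.
  It yields uniqueness and, later, measurability of the enumeration by induction on the index.\<close>

lemma enumerates_consecutive:
  assumes "enumerates T A"
  shows "T (n + 1) = t \<longleftrightarrow> t \<in> A \<and> T n < t \<and> (\<forall>r. T n < r \<and> r < t \<longrightarrow> r \<notin> A)"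
    and "T (n - 1) = t \<longleftrightarrow> t \<in> A \<and> t < T n \<and> (\<forall>r. t < r \<and> r < T n \<longrightarrow> r \<notin> A)"
proof -
  have mono: "T k < T l \<longleftrightarrow> k < l" for k l
    using assms strict_mono_less by (auto simp: enumerates_def)
  have A: "A = range T" using assms by (simp add: enumerates_def)
  have next_iff: "t \<in> A \<and> T n < t \<and> (\<forall>r. T n < r \<and> r < t \<longrightarrow> r \<notin> A) \<longleftrightarrow> T (n + 1) = t"
  proof safe
    assume *: "t \<in> A" "T n < t" "\<forall>r. T n < r \<and> r < t \<longrightarrow> r \<notin> A"
    then obtain k where k: "t = T k" using A by auto
    have "n < k" using * k mono by simp
    moreover have "\<not> n + 1 < k" using * k mono[of n "n + 1"] mono[of "n + 1" k] A by auto
    ultimately have "k = n + 1" by linarith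
    then show "T (n + 1) = t" using k by simp
  qed (auto simp: A mono)
  then show "T (n + 1) = t \<longleftrightarrow> t \<in> A \<and> T n < t \<and> (\<forall>r. T n < r \<and> r < t \<longrightarrow> r \<notin> A)" by blast
  have "t \<in> A \<and> t < T n \<and> (\<forall>r. t < r \<and> r < T n \<longrightarrow> r \<notin> A) \<longleftrightarrow> T (n - 1) = t"
  proof safe
    assume *: "t \<in> A" "t < T n" "\<forall>r. t < r \<and> r < T n \<longrightarrow> r \<notin> A"
    then obtain k where k: "t = T k" using A by auto
    have "k < n" using * k mono by simp
    moreover have "\<not> k < n - 1" using * k mono[of "n - 1" n] mono[of k "n - 1"] A by auto
    ultimately have "k = n - 1" by linarith
    then show "T (n - 1) = t" using k by simp
  qed (auto simp: A mono)
  then show "T (n - 1) = t \<longleftrightarrow> t \<in> A \<and> t < T n \<and> (\<forall>r. t < r \<and> r < T n \<longrightarrow> r \<notin> A)" by blast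
qed

lemma enumerates_unique:
  assumes "enumerates T A" "enumerates T' A"
  shows "T = T'"
proof
  fix n
  show "T n = T' n"
  proof (induction n rule: int_induct[where k = 0])
    case base
    then show ?case using assms by (simp add: enumerates_def)
  next
    case (step1 i)
    then show ?case
      using enumerates_consecutive(1)[OF assms(1), of i "T' (i + 1)"]
        enumerates_consecutive(1)[OF assms(2), of i "T' (i + 1)"] by simp
  next
    case (step2 i)
    then show ?case
      using enumerates_consecutive(2)[OF assms(1), of i "T' (i - 1)"]
        enumerates_consecutive(2)[OF assms(2), of i "T' (i - 1)"] by simp
  qed
qed

text \<open>The non-negative and the non-positive elements of \<open>A\<close> are infinite sets of naturals, enumerated
  separately and glued at their common element \<open>0\<close>.\<close>

lemma enumeration_exists:
  assumes zero: "0 \<in> A" and "biinfinite A"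
  shows "\<exists>T. enumerates T A"
proof -
  define R where "R = {n::nat. int n \<in> A}"
  define L where "L = {n::nat. - int n \<in> A}"
  have "\<exists>n\<in>R. m < n" for m
  proof -
    obtain i where "i \<in> A" "int m < i" using assms by (auto simp: biinfinite_def)
    then show ?thesis by (intro bexI[of _ "nat i"]) (auto simp: R_def)
  qed
  then have infR: "infinite R" by (metis infinite_nat_iff_unbounded)
  have "\<exists>n\<in>L. m < n" for m
  proof -
    obtain i where "i \<in> A" "i < - int m" using assms by (auto simp: biinfinite_def)
    then show ?thesis by (intro bexI[of _ "nat (- i)"]) (auto simp: L_def)
  qed
  then have infL: "infinite L" by (metis infinite_nat_iff_unbounded)
  let ?r = "enumerate R" and ?l = "enumerate L"
  have r0: "?r 0 = 0" and l0: "?l 0 = 0"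
    using zero by (auto simp: enumerate_0 R_def L_def intro!: Least_equality)
  have r_mono: "?r m < ?r n" if "m < n" for m n using enumerate_mono[OF that infR] .
  have l_mono: "?l m < ?l n" if "m < n" for m n using enumerate_mono[OF that infL] .
  have r_range: "range ?r = R" and l_range: "range ?l = L"
    using infR infL by (simp_all add: range_enumerate)
  define T where "T n = (if n \<ge> 0 then int (?r (nat n)) else - int (?l (nat (- n))))" for n
  have pos_l: "?l k > 0" if "k > 0" for k using l_mono[OF that] l0 by simp
  have "strict_mono T"
  proof (rule strict_monoI)
    fix m n :: int assume "m < n"
    then consider "0 \<le> m" | "m < 0" "0 \<le> n" | "n < 0" by linarith
    then show "T m < T n"
    proof cases
      case 1
      then show ?thesis using r_mono[of "nat m" "nat n"] \<open>m < n\<close> by (simp add: T_def)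
    next
      case 2
      have "T m < 0" using 2 pos_l[of "nat (- m)"] by (simp add: T_def)
      also have "0 \<le> T n" using 2 by (simp add: T_def)
      finally show ?thesis .
    next
      case 3
      then show ?thesis using l_mono[of "nat (- n)" "nat (- m)"] \<open>m < n\<close> by (simp add: T_def)
    qed
  qed
  moreover have "range T = A"
  proof safe
    fix n show "T n \<in> A"
      using r_range l_range by (auto simp: T_def R_def L_def)
  next
    fix a assume "a \<in> A"
    show "a \<in> range T"
    proof (cases "a \<ge> 0")
      case True
      then have "nat a \<in> R" using \<open>a \<in> A\<close> by (simp add: R_def)
      then obtain k where "?r k = nat a" using r_range by (metis imageE)
      then have "T (int k) = a" using True by (simp add: T_def)
      then show ?thesis by (metis rangeI)
    next
      case False
      then have "nat (- a) \<in> L" using \<open>a \<in> A\<close> by (simp add: L_def)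
      then obtain k where k: "?l k = nat (- a)" using l_range by (metis imageE)
      with False l0 have "k > 0" by (cases k) auto
      with k False have "T (- int k) = a" by (simp add: T_def)
      then show ?thesis by (metis rangeI)
    qed
  qed
  moreover have "T 0 = 0" by (simp add: T_def r0)
  ultimately show ?thesis by (auto simp: enumerates_def)
qed

lemma enumerates_imp_biinfinite:
  assumes "enumerates T A"
  shows "0 \<in> A" "biinfinite A"
proof -
  have mono: "T n < T (n + 1)" for n
    using assms by (auto simp: enumerates_def strict_mono_def)
  have A: "A = range T" and T0: "T 0 = 0" using assms by (auto simp: enumerates_def)
  then show "0 \<in> A" by (metis rangeI)
  have up: "int n \<le> T (int n)" for n
  proof (induction n)
    case (Suc n)
    then show ?case using mono[of "int n"] by (simp add: algebra_simps)
  qed (simp add: T0)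
  have down: "T (- int n) \<le> - int n" for n
  proof (induction n)
    case (Suc n)
    have "- int (Suc n) + 1 = - int n" by simp
    with Suc mono[of "- int (Suc n)"] show ?case by simp
  qed (simp add: T0)
  show "biinfinite A"
    unfolding biinfinite_def
  proof (intro allI conjI)
    fix m
    have "T (- int (nat (1 - m))) < m" using down[of "nat (1 - m)"] by linarith
    then show "\<exists>i\<in>A. i < m" using A by blast
    have "m < T (int (nat (m + 1)))" using up[of "nat (m + 1)"] by linarith
    then show "\<exists>i\<in>A. m < i" using A by blast
  qed
qed

lemma point_enum_eq: "enumerates T A \<Longrightarrow> point_enum A = T"
  unfolding point_enum_def enumerates_def[symmetric] by (blast intro: the_equality enumerates_unique)

lemma point_enum_enumerates:
  "0 \<in> A \<Longrightarrow> biinfinite A \<Longrightarrow> enumerates (point_enum A) A"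
  using enumeration_exists point_enum_eq by metis

lemma gap_0_greater_iff:
  assumes "0 \<in> A" "biinfinite A"
  shows "m < gap 0 A \<longleftrightarrow> (\<forall>i. 0 < i \<and> i \<le> int m \<longrightarrow> i \<notin> A)"
proof -
  note T = point_enum_enumerates[OF assms]
  have T0: "point_enum A 0 = 0" using T by (simp add: enumerates_def)
  define t where "t = point_enum A 1"
  have t: "t \<in> A" "0 < t" "\<And>r. 0 < r \<and> r < t \<Longrightarrow> r \<notin> A"
    using enumerates_consecutive(1)[OF T, of 0 t] by (auto simp: t_def T0)
  have "gap 0 A = nat t" by (simp add: gap_def t_def T0)
  with t show ?thesis by (auto simp: zless_nat_conj)
qed

section \<open>Measurability\<close>

lemma space_point_configs [simp]: "space point_configs = UNIV"
  by (simp add: point_configs_def)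

lemma pred_mem_point_configs [measurable]: "Measurable.pred point_configs (\<lambda>A. i \<in> A)"
  by (auto simp: pred_def point_configs_def intro!: in_measure_of)

lemma measurable_point_configsI:
  assumes "\<And>i. Measurable.pred M (\<lambda>\<omega>. i \<in> X \<omega>)"
  shows "X \<in> measurable M point_configs"
  unfolding point_configs_def
proof (rule measurable_measure_of)
  fix B assume "B \<in> range (\<lambda>i::int. {A. i \<in> A})"
  then obtain i where "B = {A. i \<in> A}" by auto
  then show "X -` B \<inter> space M \<in> sets M"
    using assms[of i] by (simp add: pred_def vimage_def Int_def conj_commute)
qed auto

lemma measurable_shift [measurable]:
  "(\<lambda>A. (\<lambda>i. i + s) ` A) \<in> measurable point_configs point_configs"
proof (rule measurable_point_configsI)
  fix i
  have "(\<lambda>A. i \<in> (\<lambda>i. i + s) ` A) = (\<lambda>A. i - s \<in> A)"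
    by (force simp: image_iff)
  then show "Measurable.pred point_configs (\<lambda>A. i \<in> (\<lambda>i. i + s) ` A)" by simp
qed

lemma pred_biinfinite [measurable]: "Measurable.pred point_configs biinfinite"
proof -
  have "biinfinite = (\<lambda>A. \<forall>m. (\<exists>i. i \<in> A \<and> i < m) \<and> (\<exists>i. i \<in> A \<and> m < i))"
    by (auto simp: biinfinite_def fun_eq_iff)
  moreover have "Measurable.pred point_configs
      (\<lambda>A. \<forall>m. (\<exists>i. i \<in> A \<and> i < m) \<and> (\<exists>i. i \<in> A \<and> (m::int) < i))"
    by measurable
  ultimately show ?thesis by simp
qed

lemma pred_point_enum:
  "Measurable.pred point_configs (\<lambda>A. 0 \<in> A \<and> biinfinite A \<and> point_enum A n = t)"
proof (induction n arbitrary: t rule: int_induct[where k = 0])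
  case base
  have "(\<lambda>A. 0 \<in> A \<and> biinfinite A \<and> point_enum A 0 = t)
      = (\<lambda>A. 0 \<in> A \<and> biinfinite A \<and> 0 = t)"
    using point_enum_enumerates by (auto simp: enumerates_def fun_eq_iff)
  then show ?case by simp
next
  case (step1 n)
  note [measurable] = step1(2)
  have "(\<lambda>A. 0 \<in> A \<and> biinfinite A \<and> point_enum A (n + 1) = t)
      = (\<lambda>A. \<exists>s. (0 \<in> A \<and> biinfinite A \<and> point_enum A n = s) \<and>
               t \<in> A \<and> s < t \<and> (\<forall>r. s < r \<and> r < t \<longrightarrow> r \<notin> A))"
    using enumerates_consecutive(1)[OF point_enum_enumerates] by (auto simp: fun_eq_iff)
  also have "Measurable.pred point_configs \<dots>" by measurable
  finally show ?case .
next
  case (step2 n)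
  note [measurable] = step2(2)
  have "(\<lambda>A. 0 \<in> A \<and> biinfinite A \<and> point_enum A (n - 1) = t)
      = (\<lambda>A. \<exists>s. (0 \<in> A \<and> biinfinite A \<and> point_enum A n = s) \<and>
               t \<in> A \<and> t < s \<and> (\<forall>r. t < r \<and> r < s \<longrightarrow> r \<notin> A))"
    using enumerates_consecutive(2)[OF point_enum_enumerates] by (auto simp: fun_eq_iff)
  also have "Measurable.pred point_configs \<dots>" by measurable
  finally show ?case .
qed

text \<open>On configurations that have no enumeration, \<open>point_enum\<close> is one fixed junk function, the same for
  all of them, so \<open>gap n\<close> is constant there.\<close>

lemma measurable_gap [measurable]: "gap n \<in> measurable point_configs (count_space UNIV)"
proof -
  note [measurable] = pred_point_enum
  let ?junk = "(THE T::int \<Rightarrow> int. False)"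
  have junk: "point_enum A = ?junk" if "\<not> (0 \<in> A \<and> biinfinite A)" for A
    using that enumerates_imp_biinfinite[of _ A]
    unfolding point_enum_def enumerates_def[symmetric] by (metis (full_types))
  have eq: "(\<lambda>A. gap n A = g) = (\<lambda>A.
      (\<exists>s t. (0 \<in> A \<and> biinfinite A \<and> point_enum A n = s) \<and>
        (0 \<in> A \<and> biinfinite A \<and> point_enum A (n + 1) = t) \<and> nat (t - s) = g) \<or>
      (\<not> (0 \<in> A \<and> biinfinite A) \<and> nat (?junk (n + 1) - ?junk n) = g))" (is "_ = ?P")
    for g :: nat
  proof
    fix A
    show "(gap n A = g) = ?P A" using junk[of A] by (cases "0 \<in> A \<and> biinfinite A") (auto simp: gap_def)
  qed
  have "Measurable.pred point_configs (\<lambda>A. gap n A = g)" for g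
    unfolding eq by measurable
  then show ?thesis
    by (subst measurable_count_space_eq2_countable)
      (auto simp: pred_def vimage_def)
qed

section \<open>Void probabilities of a stationary renewal process\<close>

locale stationary_renewal = prob_space M for M :: "'w measure" +
  fixes G :: "nat pmf" and X :: "'w \<Rightarrow> int set"
  assumes srp: "stationary_renewal_process M G X"
begin

lemma measurable_X [measurable]: "X \<in> measurable M point_configs"
  using srp by (simp add: stationary_renewal_process_def)

lemma AE_biinfinite: "AE \<omega> in M. biinfinite (X \<omega>)"
  using srp by (simp add: stationary_renewal_process_def biinfinite_def)

lemma emeasure_shift:
  assumes "Measurable.pred point_configs P"
  shows "emeasure M {\<omega> \<in> space M. P ((\<lambda>i. i + s) ` X \<omega>)} = emeasure M {\<omega> \<in> space M. P (X \<omega>)}"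
proof -
  have [measurable]: "{A. P A} \<in> sets point_configs" using assms by (simp add: pred_def)
  have "emeasure M {\<omega> \<in> space M. P ((\<lambda>i. i + s) ` X \<omega>)}
      = emeasure (distr M point_configs (\<lambda>\<omega>. (\<lambda>i. i + s) ` X \<omega>)) {A. P A}"
    by (subst emeasure_distr) (auto simp: vimage_def Int_def conj_commute)
  also have "\<dots> = emeasure (distr M point_configs X) {A. P A}"
    using srp by (simp add: stationary_renewal_process_def)
  also have "\<dots> = emeasure M {\<omega> \<in> space M. P (X \<omega>)}"
    by (subst emeasure_distr) (auto simp: vimage_def Int_def conj_commute)
  finally show ?thesis .
qed

text \<open>The probability that a given site is a point; stationarity makes it independent of the site.\<close>

definition intensity :: ennreal where "intensity = emeasure M {\<omega> \<in> space M. 0 \<in> X \<omega>}"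

lemma intensity_finite: "intensity \<noteq> \<infinity>"
  by (simp add: intensity_def)

lemma emeasure_mem: "emeasure M {\<omega> \<in> space M. i \<in> X \<omega>} = intensity"
proof -
  have "(\<lambda>\<omega>. 0 \<in> (\<lambda>l. l + (- i)) ` X \<omega>) = (\<lambda>\<omega>. i \<in> X \<omega>)"
    by (force simp: image_iff)
  then show ?thesis using emeasure_shift[of "\<lambda>A. 0 \<in> A" "- i"] by (simp add: intensity_def fun_eq_iff)
qed

lemma intensity_nonzero: "intensity \<noteq> 0"
proof
  assume "intensity = 0"
  then have "AE \<omega> in M. i \<notin> X \<omega>" for i
    using emeasure_mem[of i] by (subst AE_iff_measurable[OF _ refl]) auto
  then have "AE \<omega> in M. \<forall>i. i \<notin> X \<omega>" unfolding AE_all_countable by blast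
  with AE_biinfinite have "AE \<omega> in M. False"
    by eventually_elim (auto simp: biinfinite_def)
  then show False by simp
qed

text \<open>Given that \<open>0\<close> is a point, the length of the void to its right is governed by the gap
  with index \<open>0\<close>, whose conditional law is \<open>G\<close>.\<close>

lemma emeasure_gap:
  "emeasure M {\<omega> \<in> space M. 0 \<in> X \<omega> \<and> (\<forall>i. 0 < i \<and> i \<le> int m \<longrightarrow> i \<notin> X \<omega>)}
    = intensity * emeasure (measure_pmf G) {g. m < g}"
proof -
  let ?Z = "{\<omega> \<in> space M. 0 \<in> X \<omega>}"
  let ?M0 = "uniform_measure M ?Z"
  let ?W = "{\<omega> \<in> space M. m < gap 0 (X \<omega>)}"
  have "emeasure (measure_pmf G) {g. m < g}
      = emeasure (distr ?M0 (count_space UNIV) (\<lambda>\<omega>. gap 0 (X \<omega>))) {g. m < g}"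
    using srp by (simp add: stationary_renewal_process_def Let_def)
  also have "\<dots> = emeasure ?M0 ?W"
    by (subst emeasure_distr) (auto simp: vimage_def Int_def conj_commute)
  also have "\<dots> = emeasure M (?Z \<inter> ?W) / intensity"
    unfolding intensity_def by (rule emeasure_uniform_measure) measurable
  finally have "intensity * emeasure (measure_pmf G) {g. m < g} = intensity * (emeasure M (?Z \<inter> ?W) / intensity)"
    by simp
  also have "\<dots> = emeasure M (?Z \<inter> ?W)"
    using intensity_nonzero intensity_finite
    by (simp add: ennreal_times_divide mult.commute[of intensity] ennreal_mult_divide_eq)
  also have "\<dots> = emeasure M {\<omega> \<in> space M. 0 \<in> X \<omega> \<and> (\<forall>i. 0 < i \<and> i \<le> int m \<longrightarrow> i \<notin> X \<omega>)}"
  proof (rule emeasure_eq_AE)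
    show "AE \<omega> in M. \<omega> \<in> ?Z \<inter> ?W \<longleftrightarrow>
        \<omega> \<in> {\<omega> \<in> space M. 0 \<in> X \<omega> \<and> (\<forall>i. 0 < i \<and> i \<le> int m \<longrightarrow> i \<notin> X \<omega>)}"
      using AE_biinfinite by eventually_elim (auto simp: gap_0_greater_iff)
  qed measurable
  finally show ?thesis by simp
qed

text \<open>The void event is split according to the last point \<open>- s\<close> at or to the left of \<open>0\<close>; the shift
  by \<open>s\<close> turns each part into the event of the preceding lemma.\<close>

lemma emeasure_void:
  "emeasure M {\<omega> \<in> space M. \<forall>i. 0 < i \<and> i \<le> int m \<longrightarrow> i \<notin> X \<omega>}
    = intensity * (\<Sum>s. emeasure (measure_pmf G) {g. s + m < g})"
proof -
  define E where "E s = {\<omega> \<in> space M. - int s \<in> X \<omega> \<and>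
    (\<forall>i. - int s < i \<and> i \<le> int m \<longrightarrow> i \<notin> X \<omega>)}" for s
  have [measurable]: "E s \<in> sets M" for s unfolding E_def by measurable
  have "emeasure M {\<omega> \<in> space M. \<forall>i. 0 < i \<and> i \<le> int m \<longrightarrow> i \<notin> X \<omega>} = emeasure M (\<Union>s. E s)"
  proof (rule emeasure_eq_AE)
    show "AE \<omega> in M. \<omega> \<in> {\<omega> \<in> space M. \<forall>i. 0 < i \<and> i \<le> int m \<longrightarrow> i \<notin> X \<omega>} \<longleftrightarrow>
        \<omega> \<in> (\<Union>s. E s)"
      using AE_biinfinite
    proof eventually_elim
      case (elim \<omega>)
      show ?case
      proof
        assume *: "\<omega> \<in> {\<omega> \<in> space M. \<forall>i. 0 < i \<and> i \<le> int m \<longrightarrow> i \<notin> X \<omega>}"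
        obtain i where i: "i \<in> X \<omega>" "i < 1" using elim by (auto simp: biinfinite_def)
        define s where "s = (LEAST s. - int s \<in> X \<omega>)"
        have "- int (nat (- i)) \<in> X \<omega>" using i by simp
        then have s: "- int s \<in> X \<omega>" unfolding s_def by (rule LeastI)
        have "l \<notin> X \<omega>" if "- int s < l" "l \<le> int m" for l
        proof (cases "0 < l")
          case False
          then have "nat (- l) < s" using that by simp
          then have "- int (nat (- l)) \<notin> X \<omega>" unfolding s_def by (rule not_less_Least)
          then show ?thesis using False by simp
        qed (use * that in auto)
        then have "\<omega> \<in> E s" using * s by (simp add: E_def)
        then show "\<omega> \<in> (\<Union>s. E s)" by blast
      qed (auto simp: E_def)
    qed
  qed (auto simp: E_def)
  also have "\<dots> = (\<Sum>s. emeasure M (E s))"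
  proof (rule suminf_emeasure[symmetric])
    have "s = t" if "\<omega> \<in> E s" "\<omega> \<in> E t" for s t \<omega>
    proof (rule ccontr)
      assume "s \<noteq> t"
      then consider "- int s < - int t" | "- int t < - int s" by linarith
      then show False using that unfolding E_def by cases force+
    qed
    then show "disjoint_family E" unfolding disjoint_family_on_def by blast
  qed auto
  also have "\<dots> = (\<Sum>s. intensity * emeasure (measure_pmf G) {g. s + m < g})"
  proof (rule suminf_cong)
    fix s
    let ?P = "\<lambda>A. 0 \<in> A \<and> (\<forall>i. 0 < i \<and> i \<le> int (s + m) \<longrightarrow> i \<notin> A)"
    have mem: "j \<in> (\<lambda>i. i + int s) ` A \<longleftrightarrow> j - int s \<in> A" for j A
      by (force simp: image_iff)
    have "?P ((\<lambda>i. i + int s) ` A) \<longleftrightarrow>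
        - int s \<in> A \<and> (\<forall>i. - int s < i \<and> i \<le> int m \<longrightarrow> i \<notin> A)" for A
      unfolding mem
    proof safe
      fix i assume *: "\<forall>i. 0 < i \<and> i \<le> int (s + m) \<longrightarrow> i - int s \<notin> A"
        "- int s < i" "i \<le> int m" "i \<in> A"
      then show False using spec[OF *(1), of "i + int s"] by simp
    qed auto
    then have "E s = {\<omega> \<in> space M. ?P ((\<lambda>i. i + int s) ` X \<omega>)}"
      unfolding E_def by simp
    then show "emeasure M (E s) = intensity * emeasure (measure_pmf G) {g. s + m < g}"
      using emeasure_shift[of ?P "int s"] emeasure_gap[of "s + m"] by simp
  qed
  finally show ?thesis by simp
qed

text \<open>Case \<open>m = 0\<close> of the preceding formula: the void event is then certain. What matters is the
  resulting lower bound on the intensity, which is the same for all rows.\<close>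

lemma intensity_times_mean: "1 \<le> intensity * (\<integral>\<^sup>+ g. of_nat g \<partial>measure_pmf G)"
proof -
  have "1 = emeasure M {\<omega> \<in> space M. \<forall>i. 0 < i \<and> i \<le> int 0 \<longrightarrow> i \<notin> X \<omega>}"
  proof -
    have "{\<omega> \<in> space M. \<forall>i. 0 < i \<and> i \<le> int 0 \<longrightarrow> i \<notin> X \<omega>} = space M" by auto
    then show ?thesis by (simp add: emeasure_space_1)
  qed
  also have "\<dots> = intensity * (\<integral>\<^sup>+ g. of_nat g \<partial>measure_pmf G)"
    unfolding emeasure_void by (subst nn_integral_nat_function) auto
  finally show ?thesis by simp
qed

lemma emeasure_void_window:
  "emeasure M {\<omega> \<in> space M. \<forall>i. \<bar>i\<bar> \<le> int R \<longrightarrow> i \<notin> X \<omega>}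
    = intensity * (\<Sum>s. emeasure (measure_pmf G) {g. s + (2 * R + 1) < g})"
proof -
  let ?P = "\<lambda>A. \<forall>i. 0 < i \<and> i \<le> int (2 * R + 1) \<longrightarrow> i \<notin> A"
  have mem: "j \<in> (\<lambda>i. i + int (R + 1)) ` A \<longleftrightarrow> j - int (R + 1) \<in> A" for j A
    by (force simp: image_iff)
  have "?P ((\<lambda>i. i + int (R + 1)) ` A) \<longleftrightarrow> (\<forall>i. \<bar>i\<bar> \<le> int R \<longrightarrow> i \<notin> A)" for A
    unfolding mem
  proof safe
    fix i assume *: "\<forall>i. 0 < i \<and> i \<le> int (2 * R + 1) \<longrightarrow> i - int (R + 1) \<notin> A"
      "\<bar>i\<bar> \<le> int R" "i \<in> A"
    from *(2) have "0 < i + int (R + 1)" "i + int (R + 1) \<le> int (2 * R + 1)" by linarith+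
    with *(3) show False using spec[OF *(1), of "i + int (R + 1)"] by simp
  qed auto
  then show ?thesis
    using emeasure_shift[of ?P "int (R + 1)"] emeasure_void[of "2 * R + 1"] by simp
qed

end

section \<open>A gap distribution with zero interface velocity\<close>

text \<open>The gap equals \<open>4 ^ k\<close> with probability of order \<open>8 ^ - k\<close>. Its mean is finite, whereas its second
  moment is infinite: a window of radius \<open>4 ^ k\<close> is void with probability of order \<open>2 ^ - k\<close>, which
  is much more than the inverse of its length.\<close>

definition heavy_gap :: "nat pmf" where
  "heavy_gap = map_pmf (\<lambda>k. 4 ^ k) (geometric_pmf (7/8))"

lemma pmf_heavy_gap: "pmf heavy_gap (4 ^ k) = 7/8 * (1/8) ^ k"
proof -
  have "inj (\<lambda>k::nat. (4::nat) ^ k)" by (rule injI) simp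
  then have "pmf heavy_gap (4 ^ k) = pmf (geometric_pmf (7/8)) k"
    unfolding heavy_gap_def by (rule pmf_map_inj')
  then show ?thesis by (simp add: mult.commute)
qed

lemma heavy_gap_mean: "(\<integral>\<^sup>+ g. of_nat g \<partial>measure_pmf heavy_gap) = ennreal (7/4)"
proof -
  have "(\<integral>\<^sup>+ g. of_nat g \<partial>measure_pmf heavy_gap)
      = (\<integral>\<^sup>+ k. of_nat (4 ^ k) \<partial>measure_pmf (geometric_pmf (7/8)))"
    unfolding heavy_gap_def by simp
  also have "\<dots> = (\<Sum>k. ennreal (pmf (geometric_pmf (7/8)) k) * of_nat (4 ^ k))"
    by (subst nn_integral_measure_pmf, subst nn_integral_count_space_nat) (rule refl)
  also have "\<dots> = (\<Sum>k. ennreal (7/8 * (1/2) ^ k))"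
  proof (rule suminf_cong)
    fix k
    have "of_nat (4 ^ k) = ennreal (4 ^ k)"
      by (subst ennreal_of_nat_eq_real_of_nat) simp
    moreover have "pmf (geometric_pmf (7/8)) k = (1/8) ^ k * (7/8)" by simp
    ultimately have "ennreal (pmf (geometric_pmf (7/8)) k) * of_nat (4 ^ k)
        = ennreal ((1/8) ^ k * (7/8) * 4 ^ k)"
      by (simp only: ennreal_mult'' zero_le_power zero_le_numeral)
    also have "(1/8) ^ k * (7/8) * 4 ^ k = 7/8 * (1/2::real) ^ k"
      using power_mult_distrib[of "1/8::real" 4 k] by (simp add: mult_ac)
    finally show "ennreal (pmf (geometric_pmf (7/8)) k) * of_nat (4 ^ k) = ennreal (7/8 * (1/2) ^ k)" .
  qed
  also have "\<dots> = ennreal (7/4)"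
  proof (rule suminf_ennreal_eq)
    show "(\<lambda>k. 7/8 * (1/2) ^ k) sums (7/4::real)"
      using sums_mult[OF geometric_sums[of "1/2::real"], of "7/8"] by simp
  qed simp
  finally show ?thesis .
qed

lemma gap_distribution_heavy: "gap_distribution heavy_gap"
  unfolding gap_distribution_def
proof
  show "0 \<notin> set_pmf heavy_gap" by (auto simp: heavy_gap_def)
  show "integrable (measure_pmf heavy_gap) real"
    using heavy_gap_mean by (intro integrableI_nonneg) (auto simp: ennreal_of_nat_eq_real_of_nat)
qed

text \<open>Only gaps of length exactly \<open>4 ^ (k + 1)\<close> are counted. Such a gap covers the window of
  \<open>2 * 4 ^ k + 1\<close> sites from at least \<open>4 ^ k\<close> different positions.\<close>

lemma heavy_void_window:
  assumes "stationary_renewal M heavy_gap X"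
  shows "(1/2) ^ k / 16 \<le> measure M {\<omega> \<in> space M. \<forall>i. \<bar>i\<bar> \<le> int (4 ^ k) \<longrightarrow> i \<notin> X \<omega>}"
proof -
  interpret stationary_renewal M heavy_gap X by fact
  obtain r where r: "intensity = ennreal r" "0 \<le> r" using intensity_finite by (cases intensity) auto
  have "1 \<le> ennreal (r * (7/4))"
    using intensity_times_mean r(2) unfolding heavy_gap_mean r(1) by (subst ennreal_mult') auto
  then have "1 \<le> r * (7/4)" by (simp only: ennreal_ge_1)
  then have r_ge: "4/7 \<le> r" by simp
  have "ennreal (7/64 * (1/2) ^ k) = (\<Sum>s<(4::nat) ^ k. ennreal (pmf heavy_gap (4 ^ (k + 1))))"
  proof -
    have "7/64 * (1/2) ^ k = 4 ^ k * (7/8 * (1/8) ^ (k + 1) :: real)"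
      using power_mult_distrib[of "1/8::real" 4 k] by (simp add: mult_ac)
    then show ?thesis
      unfolding pmf_heavy_gap
      by (simp add: ennreal_of_nat_eq_real_of_nat flip: ennreal_mult')
  qed
  also have "\<dots> \<le> (\<Sum>s<(4::nat) ^ k. emeasure (measure_pmf heavy_gap) {g. s + (2 * 4 ^ k + 1) < g})"
  proof (rule sum_mono)
    fix s :: nat assume "s \<in> {..<4 ^ k}"
    then have "{4 ^ (k + 1)} \<subseteq> {g. s + (2 * 4 ^ k + 1) < g}" by auto
    then show "ennreal (pmf heavy_gap (4 ^ (k + 1)))
        \<le> emeasure (measure_pmf heavy_gap) {g. s + (2 * 4 ^ k + 1) < g}"
      unfolding emeasure_pmf_single[symmetric] by (rule emeasure_mono) simp
  qed
  also have "\<dots> \<le> (\<Sum>s. emeasure (measure_pmf heavy_gap) {g. s + (2 * 4 ^ k + 1) < g})"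
    by (rule sum_le_suminf) auto
  finally have tail: "ennreal (7/64 * (1/2) ^ k)
      \<le> (\<Sum>s. emeasure (measure_pmf heavy_gap) {g. s + (2 * 4 ^ k + 1) < g})" .
  have "ennreal ((1/2) ^ k / 16) \<le> ennreal (r * (7/64 * (1/2) ^ k))"
    using mult_right_mono[OF r_ge, of "7/64 * (1/2) ^ k"] by (intro ennreal_leI) simp
  also have "\<dots> = intensity * ennreal (7/64 * (1/2) ^ k)" using r by (simp only: ennreal_mult')
  also have "\<dots> \<le> emeasure M {\<omega> \<in> space M. \<forall>i. \<bar>i\<bar> \<le> int (4 ^ k) \<longrightarrow> i \<notin> X \<omega>}"
    unfolding emeasure_void_window using tail by (rule mult_left_mono) simp
  finally show ?thesis unfolding emeasure_eq_measure by (simp add: ennreal_le_iff)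
qed

text \<open>By independence, the probability that all of the \<open>3 ^ k\<close> lowest rows have a point in the
  window of radius \<open>4 ^ k\<close> is at most \<open>(1 - 2 ^ - k / 16) ^ 3 ^ k \<le> exp (- (3/2) ^ k / 16)\<close>, which is summable. The
  base \<open>3\<close> is chosen strictly between \<open>2\<close>, so that the sum converges, and \<open>4\<close>, so that the
  number of rows is negligible compared with the time \<open>4 ^ k\<close>.\<close>

lemma heavy_some_row_void:
  assumes "prob_space M" and srp: "\<And>j. stationary_renewal_process M heavy_gap (X j)"
    and indep: "prob_space.indep_vars M (\<lambda>_. point_configs) X (UNIV :: nat set)"
  shows "AE \<omega> in M. \<forall>\<^sub>F k in sequentially.
    \<exists>j<3 ^ k. \<forall>i. \<bar>i\<bar> \<le> int (4 ^ k) \<longrightarrow> i \<notin> X j \<omega>"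
proof -
  interpret prob_space M by fact
  have loc: "stationary_renewal M heavy_gap (X j)" for j
    using srp assms(1) by (simp add: stationary_renewal_def stationary_renewal_axioms_def)
  have [measurable]: "X j \<in> measurable M point_configs" for j
    using srp by (simp add: stationary_renewal_process_def)
  \<comment> \<open>\<open>V k j\<close>: row \<open>j\<close> meets the window; \<open>B k\<close>: all of the lowest \<open>3 ^ k\<close> rows do.\<close>
  define V where "V k j = {\<omega> \<in> space M. \<exists>i. \<bar>i\<bar> \<le> int (4 ^ k) \<and> i \<in> X j \<omega>}" for k :: nat and j
  define B where "B k = (\<Inter>j\<in>{..<3 ^ k}. V k j)" for k :: nat
  have [measurable]: "V k j \<in> sets M" for k j unfolding V_def by measurable
  have B_sets [measurable]: "B k \<in> sets M" for k
    unfolding B_def by (rule sets.countable_INT) (auto simp: lessThan_empty_iff)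
  have V_le: "prob (V k j) \<le> 1 - (1/2) ^ k / 16" for k j
  proof -
    let ?E = "{\<omega> \<in> space M. \<forall>i. \<bar>i\<bar> \<le> int (4 ^ k) \<longrightarrow> i \<notin> X j \<omega>}"
    have "V k j = space M - ?E" by (auto simp: V_def)
    then have "prob (V k j) = 1 - prob ?E" by (subst prob_compl[symmetric]) auto
    then show ?thesis using heavy_void_window[OF loc, of k j] by simp
  qed
  have B_le: "prob (B k) \<le> 16 * (2/3) ^ k" for k
  proof -
    let ?c = "(1/2::real) ^ k / 16"
    have "indep_events (\<lambda>j. {\<omega> \<in> space M. \<exists>i. \<bar>i\<bar> \<le> int (4 ^ k) \<and> i \<in> X j \<omega>}) UNIV"
    proof (rule indep_eventsI_indep_vars[OF indep])
      have "Measurable.pred point_configs (\<lambda>A. \<exists>i. \<bar>i\<bar> \<le> int (4 ^ k) \<and> i \<in> A)" by measurable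
      then show "{A \<in> space point_configs. \<exists>i. \<bar>i\<bar> \<le> int (4 ^ k) \<and> i \<in> A} \<in> sets point_configs"
        unfolding pred_def .
    qed
    then have "prob (B k) = (\<Prod>j<3 ^ k. prob (V k j))"
      unfolding B_def V_def indep_events_def by (auto simp: lessThan_empty_iff)
    also have "\<dots> \<le> (\<Prod>j<(3::nat) ^ k. 1 - ?c)"
      using V_le by (intro prod_mono) auto
    also have "\<dots> \<le> exp (- ?c) ^ 3 ^ k"
    proof -
      have "?c \<le> 1" by (simp add: power_le_one divide_le_eq_1 order.trans[of _ 1])
      then have "0 \<le> 1 - ?c" by simp
      moreover have "1 - ?c \<le> exp (- ?c)" using exp_ge_add_one_self[of "- ?c"] by simp
      ultimately have "(1 - ?c) ^ 3 ^ k \<le> exp (- ?c) ^ 3 ^ k" by (rule power_mono[rotated])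
      then show ?thesis by simp
    qed
    also have "\<dots> = exp (- ((3/2) ^ k / 16))"
      by (simp add: exp_of_nat_mult[symmetric] power_divide)
    also have "\<dots> \<le> 16 * (2/3) ^ k"
    proof -
      have "(3/2) ^ k / 16 \<le> exp ((3/2::real) ^ k / 16)"
        using exp_ge_add_one_self[of "(3/2::real) ^ k / 16"] by linarith
      then have "inverse (exp ((3/2::real) ^ k / 16)) \<le> inverse ((3/2) ^ k / 16)"
        by (intro le_imp_inverse_le) auto
      then show ?thesis by (simp add: exp_minus power_divide field_simps)
    qed
    finally show ?thesis .
  qed
  have "summable (\<lambda>k. prob (B k))"
  proof (rule summable_comparison_test')
    show "summable (\<lambda>k. 16 * (2/3) ^ k :: real)" by (intro summable_mult summable_geometric) simp
    show "norm (prob (B k)) \<le> 16 * (2/3) ^ k" if "k \<ge> 0" for k using B_le by simp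
  qed
  then have "AE \<omega> in M. \<forall>\<^sub>F k in sequentially. \<omega> \<in> space M - B k"
    by (intro borel_cantelli_AE1) (auto simp: emeasure_eq_measure)
  then show ?thesis
    by eventually_elim (auto simp: B_def V_def elim!: eventually_mono)
qed

lemma limsup_zero_if_sparse_bound:
  fixes f :: "nat \<Rightarrow> nat"
  assumes mono: "\<And>m n. m \<le> n \<Longrightarrow> f m \<le> f n"
    and bound: "\<forall>\<^sub>F k in sequentially. f (4 ^ k) \<le> 3 ^ k"
  shows "limsup (\<lambda>n. ereal (real (f n) / real n)) = 0"
proof -
  have "(\<lambda>n. real (f n) / real n) \<longlonglongrightarrow> 0"
  proof (rule LIMSEQ_I)
    fix e :: real assume "0 < e"
    have "(\<lambda>k. 3 * (3/4::real) ^ k) \<longlonglongrightarrow> 3 * 0" by (intro tendsto_mult LIMSEQ_power_zero) auto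
    then have "\<forall>\<^sub>F k in sequentially. 3 * (3/4::real) ^ k < e"
      using \<open>0 < e\<close> by (intro order_tendstoD(2)[of _ "3 * 0"]) auto
    with bound obtain K where K: "\<And>k. k \<ge> K \<Longrightarrow> f (4 ^ k) \<le> 3 ^ k"
      "\<And>k. k \<ge> K \<Longrightarrow> 3 * (3/4::real) ^ k < e"
      unfolding eventually_sequentially by (metis le_trans nat_le_linear)
    show "\<exists>N. \<forall>n\<ge>N. norm (real (f n) / real n - 0) < e"
    proof (intro exI[of _ "4 ^ K"] allI impI)
      fix n :: nat assume n: "4 ^ K \<le> n"
      obtain k where k: "4 ^ k \<le> n" "n < 4 ^ (k + 1)"
        using ex_power_ivl1[of 4 n] le_trans[OF one_le_power n] by auto
      have "K \<le> k"
      proof (rule ccontr)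
        assume "\<not> K \<le> k"
        then have "(4::nat) ^ (k + 1) \<le> 4 ^ K" by (intro power_increasing) auto
        with k n show False by simp
      qed
      have "f n \<le> f (4 ^ (k + 1))" using k by (intro mono) simp
      also have "\<dots> \<le> 3 ^ (k + 1)" using \<open>K \<le> k\<close> by (intro K) simp
      finally have "real (f n) \<le> 3 ^ (k + 1)" by (metis of_nat_le_iff of_nat_numeral of_nat_power)
      moreover have "(4::real) ^ k \<le> real n" using k(1) by (metis of_nat_le_iff of_nat_numeral of_nat_power)
      ultimately have "real (f n) / real n \<le> 3 ^ (k + 1) / 4 ^ k"
        by (intro frac_le) auto
      also have "\<dots> = 3 * (3/4) ^ k" by (simp add: power_divide)
      also have "\<dots> < e" using K(2) \<open>K \<le> k\<close> by blast
      finally show "norm (real (f n) / real n - 0) < e" by simp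
    qed
  qed
  then have "(\<lambda>n. ereal (real (f n) / real n)) \<longlonglongrightarrow> ereal 0" by (intro tendsto_ereal)
  then show ?thesis by (simp add: lim_imp_Limsup zero_ereal_def)
qed

lemma heavy_gap_zero_velocity:
  assumes "obstacle_field M heavy_gap Q"
  shows "AE \<omega> in M. limsup (\<lambda>n. ereal (real (interface (1/2) (Q \<omega>) n 0) / real n)) = 0"
proof -
  obtain X where M: "prob_space M" and srp: "\<And>j. stationary_renewal_process M heavy_gap (X j)"
    and indep: "prob_space.indep_vars M (\<lambda>_. point_configs) X (UNIV :: nat set)"
    and Q: "\<And>\<omega> i j. Q \<omega> i j = (if i \<in> X j \<omega> then 0 else 1)"
    using assms unfolding obstacle_field_def by blast
  show ?thesis
    using heavy_some_row_void[OF M srp indep]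
  proof eventually_elim
    case (elim \<omega>)
    have "\<forall>\<^sub>F k in sequentially. interface (1/2) (Q \<omega>) (4 ^ k) 0 \<le> 3 ^ k"
      using elim
    proof (rule eventually_mono)
      fix k assume "\<exists>j<3 ^ k. \<forall>i. \<bar>i\<bar> \<le> int (4 ^ k) \<longrightarrow> i \<notin> X j \<omega>"
      then obtain j where j: "j < 3 ^ k" "\<And>i. \<bar>i\<bar> \<le> int (4 ^ k) \<Longrightarrow> Q \<omega> i j = 1"
        by (auto simp: Q)
      have "interface (1/2) (Q \<omega>) (4 ^ k) 0 \<le> j"
        by (rule interface_le_blocked_row[of "4 ^ k"]) (use j in auto)
      with j show "interface (1/2) (Q \<omega>) (4 ^ k) 0 \<le> 3 ^ k" by simp
    qed
    then show ?case by (rule limsup_zero_if_sparse_bound[rotated]) (rule interface_mono)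
  qed
qed

section \<open>Construction of stationary renewal processes\<close>

text \<open>Being a stationary renewal process is a property of the law of \<open>X\<close> alone; the conditions on the
  gaps amount to saying that under the conditioned law the whole gap sequence is i.i.d.\<close>

lemma stationary_renewal_processI:
  assumes "prob_space M" and [measurable]: "X \<in> measurable M point_configs"
    and biinf: "AE A in distr M point_configs X. biinfinite A"
    and shift: "\<And>s. distr (distr M point_configs X) point_configs (\<lambda>A. (\<lambda>i. i + s) ` A)
        = distr M point_configs X"
    and pos: "emeasure M {\<omega> \<in> space M. 0 \<in> X \<omega>} \<noteq> 0"
    and palm: "distr (uniform_measure (distr M point_configs X) {A. 0 \<in> A})
        (PiM UNIV (\<lambda>_. count_space UNIV)) (\<lambda>A n. gap n A)
      = PiM (UNIV :: int set) (\<lambda>_. measure_pmf G)"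
  shows "stationary_renewal_process M G X"
proof -
  interpret prob_space M by fact
  let ?Z = "{\<omega> \<in> space M. 0 \<in> X \<omega>}"
  let ?M0 = "uniform_measure M ?Z"
  let ?P = "PiM (UNIV :: int set) (\<lambda>_. count_space (UNIV :: nat set))"
  have Z_sets: "?Z \<in> sets M" by measurable
  interpret M0: prob_space ?M0
    using pos by (intro prob_space_uniform_measure) auto
  have set0: "{A. (0::int) \<in> A} \<in> sets point_configs"
    using pred_mem_point_configs[of 0] by (simp add: pred_def)
  have law0: "distr ?M0 point_configs X = uniform_measure (distr M point_configs X) {A. 0 \<in> A}"
  proof (rule measure_eqI)
    fix B assume "B \<in> sets (distr ?M0 point_configs X)"
    then have B [measurable]: "B \<in> sets point_configs" by simp
    have X': "X \<in> measurable ?M0 point_configs" by simp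
    have "emeasure (distr ?M0 point_configs X) B = emeasure ?M0 (X -` B \<inter> space M)"
      using B by (subst emeasure_distr[OF X']) auto
    also have "\<dots> = emeasure M (?Z \<inter> (X -` B \<inter> space M)) / emeasure M ?Z"
      using Z_sets by (intro emeasure_uniform_measure) auto
    also have "\<dots> = emeasure (distr M point_configs X) ({A. 0 \<in> A} \<inter> B)
        / emeasure (distr M point_configs X) {A. 0 \<in> A}"
    proof -
      have "?Z \<inter> (X -` B \<inter> space M) = X -` ({A. 0 \<in> A} \<inter> B) \<inter> space M"
        "?Z = X -` {A. 0 \<in> A} \<inter> space M" by auto
      then show ?thesis using set0 by (simp only: emeasure_distr assms(2) B sets.Int)
    qed
    also have "\<dots> = emeasure (uniform_measure (distr M point_configs X) {A. 0 \<in> A}) B"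
      using set0 by (intro emeasure_uniform_measure[symmetric]) auto
    finally show "emeasure (distr ?M0 point_configs X) B
        = emeasure (uniform_measure (distr M point_configs X) {A. 0 \<in> A}) B" .
  qed simp
  have gap_meas: "(\<lambda>A n. gap n A) \<in> measurable point_configs ?P"
    by (rule measurable_PiM_single') (auto intro: measurable_gap)
  have gaps: "distr ?M0 ?P (\<lambda>\<omega> n. gap n (X \<omega>)) = PiM UNIV (\<lambda>_. measure_pmf G)"
  proof -
    have "distr ?M0 ?P (\<lambda>\<omega> n. gap n (X \<omega>))
        = distr (distr ?M0 point_configs X) ?P (\<lambda>A n. gap n A)"
      by (subst distr_distr) (auto intro: gap_meas simp: comp_def)
    then show ?thesis using palm by (simp add: law0)
  qed
  have gaps_meas: "(\<lambda>\<omega> n. gap n (X \<omega>)) \<in> measurable ?M0 ?P"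
    using measurable_compose[OF assms(2) gap_meas] by simp
  have gap_law: "distr ?M0 (count_space UNIV) (\<lambda>\<omega>. gap n (X \<omega>)) = measure_pmf G" for n
  proof -
    have "distr ?M0 (count_space UNIV) (\<lambda>\<omega>. gap n (X \<omega>))
        = distr (distr ?M0 ?P (\<lambda>\<omega> n. gap n (X \<omega>))) (count_space UNIV) (\<lambda>y. y n)"
      using gaps_meas by (subst distr_distr) (auto simp: comp_def)
    also have "\<dots> = distr (PiM UNIV (\<lambda>_. measure_pmf G)) (measure_pmf G) (\<lambda>y. y n)"
      unfolding gaps by (rule distr_cong) auto
    also have "\<dots> = measure_pmf G"
      by (rule distr_PiM_component) (auto intro: prob_space_measure_pmf)
    finally show ?thesis .
  qed
  have "M0.indep_vars (\<lambda>_. count_space UNIV) (\<lambda>n \<omega>. gap n (X \<omega>)) UNIV"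
    by (subst M0.indep_vars_iff_distr_eq_PiM') (auto simp: gap_law gaps restrict_UNIV)
  moreover have "AE \<omega> in M. biinfinite (X \<omega>)"
    using biinf by (rule AE_distrD[rotated]) simp
  moreover have "distr M point_configs (\<lambda>\<omega>. (\<lambda>i. i + s) ` X \<omega>) = distr M point_configs X" for s
    using shift[of s] by (subst (asm) distr_distr) (auto simp: comp_def)
  ultimately show ?thesis
    unfolding stationary_renewal_process_def Let_def biinfinite_def[symmetric]
    using gap_law by simp
qed

definition position :: "(int \<Rightarrow> nat) \<Rightarrow> int \<Rightarrow> int" where
  "position y n = (if 0 \<le> n then \<Sum>k\<in>{0..<n}. int (y k) else - (\<Sum>k\<in>{n..<0}. int (y k)))"

definition renewal_points :: "(int \<Rightarrow> nat) \<Rightarrow> int set" where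
  "renewal_points y = range (position y)"

lemma position_0: "position y 0 = 0"
  by (simp add: position_def)

lemma position_Suc: "position y (n + 1) = position y n + int (y n)"
proof -
  consider "0 \<le> n" | "n = -1" | "n < -1" by linarith
  then show ?thesis
  proof cases
    case 1
    then have "{0..<n + 1} = insert n {0..<n}" by auto
    with 1 show ?thesis by (simp add: position_def)
  next
    case 2
    have "{-1..<0} = {-1::int}" by auto
    with 2 show ?thesis by (simp add: position_def)
  next
    case 3
    then have "{n..<0} = insert n {n + 1..<0}" by auto
    with 3 show ?thesis by (simp add: position_def)
  qed
qed

lemma enumerates_renewal_points:
  assumes "\<And>n. 0 < y n"
  shows "enumerates (position y) (renewal_points y)"
proof -
  have "position y m < position y n" if "m < n" for m n
    using that
  proof (induction n rule: int_gr_induct)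
    case base
    then show ?case using assms[of m] by (simp add: position_Suc)
  next
    case (step n)
    then show ?case using assms[of n] by (simp add: position_Suc)
  qed
  then show ?thesis
    by (auto simp: enumerates_def renewal_points_def position_0 strict_mono_def)
qed

lemma gap_renewal_points:
  assumes "\<And>n. 0 < y n"
  shows "gap n (renewal_points y) = y n"
  unfolding gap_def point_enum_eq[OF enumerates_renewal_points[OF assms]] by (simp add: position_Suc)

lemma position_shift: "position (\<lambda>n. y (n + 1)) n = position y (n + 1) - int (y 0)"
proof (induction n rule: int_induct[where k = 0])
  case base
  show ?case using position_Suc[of y 0] by (simp add: position_0)
next
  case (step1 n)
  then show ?case using position_Suc[of y "n + 1"] position_Suc[of "\<lambda>n. y (n + 1)" n] by simp
next
  case (step2 n)
  then show ?case using position_Suc[of y n] position_Suc[of "\<lambda>n. y (n + 1)" "n - 1"] by simp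
qed

lemma renewal_points_shift:
  "renewal_points (\<lambda>n. y (n + 1)) = (\<lambda>i. i + - int (y 0)) ` renewal_points y"
proof -
  have "renewal_points (\<lambda>n. y (n + 1)) = (\<lambda>n. position y n - int (y 0)) ` range (\<lambda>n. n + 1)"
    unfolding renewal_points_def position_shift image_image ..
  also have "range (\<lambda>n::int. n + 1) = UNIV" by (rule surj_plus_right)
  finally show ?thesis by (simp add: renewal_points_def image_image)
qed

text \<open>The stationary law is obtained from the i.i.d. gap sequence \<open>y\<close> (the law seen from a point) by
  Palm inversion: a pair of a gap sequence and a site \<open>s\<close> of the cell \<open>{0..<y 0}\<close> is weighted by
  the product of the law of \<open>y\<close> and the counting measure, normalised by the finite mean gap, and the
  configuration is recentred at \<open>s\<close>. Long cells at the origin are thereby favoured in proportion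
  to their length.\<close>

locale renewal_construction =
  fixes G :: "nat pmf"
  assumes gap_dist: "gap_distribution G"
begin

definition gaps :: "(int \<Rightarrow> nat) measure" where
  "gaps = PiM UNIV (\<lambda>_. measure_pmf G)"

sublocale gaps: prob_space gaps
  unfolding gaps_def by (rule prob_space_PiM) (rule prob_space_measure_pmf)

lemma space_gaps [simp]: "space gaps = UNIV"
  by (simp add: gaps_def space_PiM)

lemma sets_gaps: "sets gaps = sets (PiM UNIV (\<lambda>_. count_space UNIV))"
  unfolding gaps_def by (rule sets_PiM_cong) auto

lemma measurable_gaps_component [measurable]: "(\<lambda>y. y n) \<in> measurable gaps (count_space UNIV)"
  unfolding measurable_cong_sets[OF sets_gaps refl] by simp

lemma gaps_component: "distr gaps (measure_pmf G) (\<lambda>y. y n) = measure_pmf G"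
  unfolding gaps_def by (rule distr_PiM_component) (auto intro: prob_space_measure_pmf)

lemma AE_gaps_pos: "AE y in gaps. \<forall>n. 0 < y n"
proof -
  have "AE g in measure_pmf G. 0 < g"
    using gap_dist by (auto simp: AE_measure_pmf_iff gap_distribution_def intro: gr0I)
  then have "AE y in gaps. 0 < y n" for n
    unfolding gaps_def by (intro AE_PiM_component prob_space_measure_pmf) auto
  then show ?thesis unfolding AE_all_countable by blast
qed

lemma measurable_gaps_shift: "(\<lambda>y n. y (n + 1)) \<in> measurable gaps gaps"
  unfolding measurable_cong_sets[OF refl sets_gaps]
  by (rule measurable_PiM_single') (auto intro: measurable_gaps_component)

lemma gaps_shift: "distr gaps gaps (\<lambda>y n. y (n + 1)) = gaps"
proof -
  have "distr (PiM UNIV (\<lambda>_::int. measure_pmf G)) (PiM UNIV (\<lambda>_::int. measure_pmf G))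
      (\<lambda>y. \<lambda>n\<in>UNIV. y (n + 1)) = PiM UNIV (\<lambda>_. measure_pmf G)"
    by (rule distr_PiM_reindex[where f = "\<lambda>n::int. n + 1"])
      (auto intro: prob_space_measure_pmf simp: inj_on_def)
  then show ?thesis by (simp add: gaps_def restrict_UNIV)
qed

lemma pred_position [measurable]: "Measurable.pred gaps (\<lambda>y. position y n = i)"
proof -
  have *: "(\<lambda>y. real_of_int (position y n)) = (\<lambda>y. if 0 \<le> n then \<Sum>k\<in>{0..<n}. real (y k)
      else - (\<Sum>k\<in>{n..<0}. real (y k)))"
    by (auto simp: position_def)
  have [measurable]: "(\<lambda>y. real (y k)) \<in> borel_measurable gaps" for k
    by (rule measurable_compose[OF measurable_gaps_component]) simp
  have [measurable]: "(\<lambda>y. real_of_int (position y n)) \<in> borel_measurable gaps"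
    unfolding * by (cases "0 \<le> n") (simp_all only: if_True if_False, measurable)
  have "Measurable.pred gaps (\<lambda>y. real_of_int (position y n) = real_of_int i)" by measurable
  then show ?thesis by simp
qed

lemma pred_mem_renewal_points [measurable]: "Measurable.pred gaps (\<lambda>y. i \<in> renewal_points y)"
proof -
  have "(\<lambda>y. i \<in> renewal_points y) = (\<lambda>y. \<exists>n. position y n = i)"
    by (auto simp: renewal_points_def fun_eq_iff)
  then show ?thesis by simp
qed

lemma measurable_renewal_points [measurable]: "renewal_points \<in> measurable gaps point_configs"
  by (rule measurable_point_configsI) (rule pred_mem_renewal_points)

definition mean :: ennreal where "mean = (\<integral>\<^sup>+ g. of_nat g \<partial>measure_pmf G)"

lemma mean_sum: "mean = (\<Sum>s. emeasure gaps {y. s < y 0})"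
proof -
  have "mean = (\<Sum>s. emeasure (measure_pmf G) {g. s < g})"
    unfolding mean_def by (subst nn_integral_nat_function) auto
  also have "\<dots> = (\<Sum>s. emeasure (distr gaps (measure_pmf G) (\<lambda>y. y 0)) {g. s < g})"
    by (simp add: gaps_component)
  also have "\<dots> = (\<Sum>s. emeasure gaps {y. s < y 0})"
    by (subst emeasure_distr) (auto simp: vimage_def)
  finally show ?thesis .
qed

lemma mean_finite: "mean \<noteq> \<infinity>"
proof -
  have "integrable (measure_pmf G) real" using gap_dist by (simp add: gap_distribution_def)
  then have "(\<integral>\<^sup>+ g. ennreal (real g) \<partial>measure_pmf G) < \<infinity>"
    by (subst nn_integral_eq_integral) auto
  then show ?thesis by (simp add: mean_def ennreal_of_nat_eq_real_of_nat)
qed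

lemma mean_pos: "mean \<noteq> 0"
proof
  assume "mean = 0"
  then have "AE g in measure_pmf G. g = 0"
    unfolding mean_def by (subst (asm) nn_integral_0_iff_AE) auto
  moreover have "AE g in measure_pmf G. g \<noteq> 0"
    using gap_dist by (auto simp: AE_measure_pmf_iff gap_distribution_def intro: gr0I)
  ultimately have "AE g in measure_pmf G. False" by eventually_elim simp
  then show False by simp
qed

definition marked :: "((int \<Rightarrow> nat) \<times> nat) measure" where
  "marked = uniform_measure (gaps \<Otimes>\<^sub>M count_space UNIV) {(y, s). s < y 0}"

definition recentre :: "(int \<Rightarrow> nat) \<times> nat \<Rightarrow> int set" where
  "recentre = (\<lambda>(y, s). (\<lambda>i. i + - int s) ` renewal_points y)"

definition law :: "int set measure" where
  "law = distr marked point_configs recentre"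

lemma sets_law [simp, measurable_cong]: "sets law = sets point_configs"
  and space_law [simp]: "space law = UNIV"
  by (simp_all add: law_def)

lemma emeasure_pair:
  assumes [measurable]: "E \<in> sets (gaps \<Otimes>\<^sub>M count_space (UNIV :: nat set))"
  shows "emeasure (gaps \<Otimes>\<^sub>M count_space UNIV) E = (\<Sum>s. emeasure gaps {y. (y, s) \<in> E})"
proof -
  interpret C: sigma_finite_measure "count_space (UNIV :: nat set)"
    by (rule sigma_finite_measure_count_space_countable) simp
  interpret pair_sigma_finite gaps "count_space (UNIV :: nat set)" ..
  show ?thesis
    by (subst emeasure_pair_measure_alt2[OF assms], subst nn_integral_count_space_nat)
      (simp add: vimage_def)
qed

lemma marks_sets [measurable]: "{(y, s). s < y 0} \<in> sets (gaps \<Otimes>\<^sub>M count_space (UNIV :: nat set))"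
proof -
  let ?M = "gaps \<Otimes>\<^sub>M count_space (UNIV :: nat set)"
  have [measurable]: "(\<lambda>p. fst p 0) \<in> measurable ?M (count_space UNIV)"
    by (rule measurable_compose[OF measurable_fst measurable_gaps_component])
  have "(\<lambda>p. snd p < fst p 0) = (\<lambda>p. \<exists>s t. s = snd p \<and> t = fst p (0::int) \<and> s < (t::nat))"
    by auto
  also have "Measurable.pred ?M \<dots>" by measurable
  finally show ?thesis by (simp add: pred_def space_pair_measure case_prod_beta')
qed

lemma measurable_recentre [measurable]:
  "recentre \<in> measurable (gaps \<Otimes>\<^sub>M count_space (UNIV :: nat set)) point_configs"
proof (rule measurable_point_configsI)
  fix i
  have "(\<lambda>p. i \<in> recentre p) = (\<lambda>p. \<exists>s. s = snd p \<and> i + int s \<in> renewal_points (fst p))"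
    by (force simp: recentre_def fun_eq_iff image_iff)
  then show "Measurable.pred (gaps \<Otimes>\<^sub>M count_space UNIV) (\<lambda>p. i \<in> recentre p)" by simp
qed

lemma emeasure_law:
  assumes B: "B \<in> sets point_configs"
  shows "emeasure law B
    = (\<Sum>s. emeasure gaps {y. s < y 0 \<and> (\<lambda>i. i + - int s) ` renewal_points y \<in> B}) / mean"
proof -
  let ?M = "gaps \<Otimes>\<^sub>M count_space (UNIV :: nat set)"
  let ?A = "{(y, s). s < y 0} :: ((int \<Rightarrow> nat) \<times> nat) set"
  have "recentre -` B \<inter> space ?M \<in> sets ?M" by (rule measurable_sets[OF measurable_recentre B])
  then have R [measurable]: "recentre -` B \<in> sets ?M" by (simp add: space_pair_measure)
  have "emeasure law B = emeasure marked (recentre -` B)"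
    unfolding law_def using B
    by (subst emeasure_distr) (simp_all add: marked_def space_pair_measure)
  also have "\<dots> = emeasure ?M (?A \<inter> recentre -` B) / emeasure ?M ?A"
    unfolding marked_def by (rule emeasure_uniform_measure[OF marks_sets R])
  also have "emeasure ?M ?A = mean"
    by (subst emeasure_pair) (simp_all add: mean_sum marks_sets)
  also have "emeasure ?M (?A \<inter> recentre -` B)
      = (\<Sum>s. emeasure gaps {y. s < y 0 \<and> (\<lambda>i. i + - int s) ` renewal_points y \<in> B})"
    by (subst emeasure_pair[OF sets.Int[OF marks_sets R]]) (simp add: recentre_def)
  finally show ?thesis .
qed

lemma prob_space_law: "prob_space law"
proof
  show "emeasure law (space law) = 1"
    using emeasure_law[of UNIV] mean_pos mean_finite sets.top[of point_configs]
    by (simp add: ennreal_divide_self less_top flip: mean_sum)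
qed

text \<open>Moving the origin one site to the right moves \<open>s\<close> to \<open>s + 1\<close>. If that is still inside the cell,
  nothing else happens. Otherwise the new origin is the point that ends the cell, and the
  configuration seen from it has the gap sequence \<open>y\<close> shifted by one index, which is again i.i.d.; this
  contribution \<open>\<Sum>s. d s\<close> replaces the lost term \<open>a 0\<close>.\<close>

lemma law_shift_left: "distr law point_configs (\<lambda>A. (\<lambda>i. i + - 1) ` A) = law"
proof (rule measure_eqI)
  fix B assume "B \<in> sets (distr law point_configs (\<lambda>A. (\<lambda>i. i + - 1) ` A))"
  then have B [measurable]: "B \<in> sets point_configs" by simp
  let ?S = "\<lambda>s y. (\<lambda>i. i + - int s) ` renewal_points y"
  define a where "a s = emeasure gaps {y. s < y 0 \<and> ?S s y \<in> B}" for s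
  define d where "d s = emeasure gaps {y. y 0 = Suc s \<and> ?S (Suc s) y \<in> B}" for s
  have S_meas: "?S s \<in> measurable gaps point_configs" for s
    by (rule measurable_compose[OF measurable_renewal_points measurable_shift])
  have S_pred [measurable]: "Measurable.pred gaps (\<lambda>y. ?S s y \<in> B)" for s
    using measurable_sets[OF S_meas B] by (simp add: pred_def vimage_def)
  have y_pred [measurable]: "Measurable.pred gaps (\<lambda>y. P (y n))" for P :: "nat \<Rightarrow> bool" and n
    by (rule measurable_compose[OF measurable_gaps_component]) simp
  have sets_y [measurable]: "{y. P (y 0) \<and> ?S s y \<in> B} \<in> sets gaps" for P :: "nat \<Rightarrow> bool" and s
  proof -
    have "Measurable.pred gaps (\<lambda>y. P (y 0) \<and> ?S s y \<in> B)" by measurable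
    then show ?thesis by (simp add: pred_def)
  qed
  have split: "emeasure gaps {y. s < y 0 \<and> ?S (Suc s) y \<in> B} = a (Suc s) + d s" for s
  proof -
    have "{y. s < y 0 \<and> ?S (Suc s) y \<in> B}
        = {y. Suc s < y 0 \<and> ?S (Suc s) y \<in> B} \<union> {y. y 0 = Suc s \<and> ?S (Suc s) y \<in> B}"
      by auto
    then show ?thesis
      unfolding a_def d_def
      using sets_y[of "\<lambda>g. Suc s < g" "Suc s"] sets_y[of "\<lambda>g. g = Suc s" "Suc s"]
      by (simp only:) (intro plus_emeasure[symmetric], auto)
  qed
  have shifted: "(\<lambda>i. i + - 1) ` ?S s y = ?S (Suc s) y" for s y
    by (simp add: image_image algebra_simps)
  have shift_meas: "(\<lambda>A. (\<lambda>i. i + - 1) ` A) \<in> measurable law point_configs"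
    unfolding measurable_cong_sets[OF sets_law refl] by (rule measurable_shift)
  have shifted_sets: "{A. (\<lambda>i. i + - 1) ` A \<in> B} \<in> sets point_configs"
    using measurable_sets[OF measurable_shift[of "- 1"] B] by (simp add: vimage_def)
  have "emeasure (distr law point_configs (\<lambda>A. (\<lambda>i. i + - 1) ` A)) B
      = emeasure law {A. (\<lambda>i. i + - 1) ` A \<in> B}"
    using B by (subst emeasure_distr[OF shift_meas]) (auto simp: vimage_def)
  then have left: "emeasure (distr law point_configs (\<lambda>A. (\<lambda>i. i + - 1) ` A)) B
      = (\<Sum>s. a (Suc s) + d s) / mean"
    unfolding emeasure_law[OF shifted_sets] mem_Collect_eq shifted split .
  have "(\<Sum>s. d s) = emeasure gaps (\<Union>s. {y. y 0 = Suc s \<and> ?S (Suc s) y \<in> B})"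
    unfolding d_def
  proof (rule suminf_emeasure)
    show "range (\<lambda>s. {y. y 0 = Suc s \<and> ?S (Suc s) y \<in> B}) \<subseteq> sets gaps"
      using sets_y[of "\<lambda>g. g = Suc s" "Suc s" for s] by blast
    show "disjoint_family (\<lambda>s. {y. y 0 = Suc s \<and> ?S (Suc s) y \<in> B})"
      by (auto simp: disjoint_family_on_def)
  qed
  also have "\<dots> = emeasure gaps {y. renewal_points (\<lambda>n. y (n + 1)) \<in> B}"
  proof (rule emeasure_eq_AE)
    show "AE y in gaps. y \<in> (\<Union>s. {y. y 0 = Suc s \<and> ?S (Suc s) y \<in> B}) \<longleftrightarrow>
        y \<in> {y. renewal_points (\<lambda>n. y (n + 1)) \<in> B}"
      using AE_gaps_pos
    proof eventually_elim
      case (elim y)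
      then obtain k where k: "y 0 = Suc k" by (metis not0_implies_Suc less_irrefl)
      show ?case unfolding renewal_points_shift mem_Collect_eq UN_iff k by auto
    qed
    show "{y. renewal_points (\<lambda>n. y (n + 1)) \<in> B} \<in> sets gaps"
      using measurable_sets[OF measurable_compose[OF measurable_gaps_shift measurable_renewal_points] B]
      by (simp add: vimage_def)
    show "(\<Union>s. {y. y 0 = Suc s \<and> ?S (Suc s) y \<in> B}) \<in> sets gaps"
      using sets_y[of "\<lambda>g. g = Suc s" "Suc s" for s] by (intro sets.countable_UN) blast
  qed
  also have "\<dots> = emeasure (distr gaps gaps (\<lambda>y n. y (n + 1))) {y. renewal_points y \<in> B}"
    using measurable_sets[OF measurable_renewal_points B]
    by (subst emeasure_distr[OF measurable_gaps_shift]) (simp_all add: vimage_def)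
  also have "\<dots> = a 0"
    unfolding gaps_shift a_def
  proof (rule emeasure_eq_AE)
    show "AE y in gaps. y \<in> {y. renewal_points y \<in> B} \<longleftrightarrow> y \<in> {y. 0 < y 0 \<and> ?S 0 y \<in> B}"
      using AE_gaps_pos by eventually_elim simp
    show "{y. renewal_points y \<in> B} \<in> sets gaps"
      using measurable_sets[OF measurable_renewal_points B] by (simp add: vimage_def)
  qed (rule sets_y)
  finally have d_sum: "(\<Sum>s. d s) = a 0" .
  have "(\<Sum>s. a (Suc s) + d s) = (\<Sum>s. a (Suc s)) + a 0"
    unfolding d_sum[symmetric] by (rule suminf_add[symmetric]) auto
  also have "\<dots> = (\<Sum>s. a s)"
    by (intro sums_unique sums_Suc summable_sums) auto
  finally show "emeasure (distr law point_configs (\<lambda>A. (\<lambda>i. i + - 1) ` A)) B = emeasure law B"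
    unfolding left emeasure_law[OF B] a_def by simp
qed simp

lemma law_shift: "distr law point_configs (\<lambda>A. (\<lambda>i. i + s) ` A) = law"
proof -
  let ?D = "\<lambda>s. distr law point_configs (\<lambda>A. (\<lambda>i. i + s) ` A)"
  have sh: "(\<lambda>A. (\<lambda>i. i + s) ` A) \<in> measurable law point_configs" for s
    by (simp add: measurable_cong_sets[OF sets_law refl])
  have comp: "distr (?D s) point_configs (\<lambda>A. (\<lambda>i. i + t) ` A) = ?D (s + t)" for s t
    by (subst distr_distr[OF measurable_shift sh]) (simp add: comp_def image_image add.assoc)
  have D0: "?D 0 = law" by (simp add: distr_id2)
  have left: "?D (-1) = law" using law_shift_left by simp
  then have right: "?D 1 = law" using comp[of "-1" 1] D0 by simp
  show ?thesis
  proof (induction s rule: int_induct[where k = 0])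
    case base
    show ?case by (fact D0)
  next
    case (step1 s)
    then show ?case using comp[of s 1] right by simp
  next
    case (step2 s)
    then show ?case using comp[of s "-1"] left by simp
  qed
qed

text \<open>The recentred configuration contains \<open>0\<close> only for the mark \<open>s = 0\<close>, since the cell
  \<open>{0..<y 0}\<close> has no other point. So conditioning on \<open>0\<close> being a point undoes the construction.\<close>

lemma palm_law: "uniform_measure law {A. 0 \<in> A} = distr gaps point_configs renewal_points"
  and law_zero: "emeasure law {A. 0 \<in> A} \<noteq> 0"
proof -
  let ?S = "\<lambda>s y. (\<lambda>i. i + - int s) ` renewal_points y"
  have Z: "{A. (0::int) \<in> A} \<in> sets point_configs"
    using pred_mem_point_configs[of 0] by (simp add: pred_def)
  have main: "emeasure law ({A. 0 \<in> A} \<inter> B) = emeasure gaps (renewal_points -` B) / mean"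
    if B: "B \<in> sets point_configs" for B
  proof -
    have S_meas: "?S s \<in> measurable gaps point_configs" for s
      by (rule measurable_compose[OF measurable_renewal_points measurable_shift])
    have sets_s: "{y. s < y 0 \<and> ?S s y \<in> {A. 0 \<in> A} \<inter> B} \<in> sets gaps" for s
    proof -
      have "Measurable.pred gaps (\<lambda>y. s < y 0)"
        by (rule measurable_compose[OF measurable_gaps_component]) simp
      moreover have "Measurable.pred gaps (\<lambda>y. ?S s y \<in> {A. 0 \<in> A} \<inter> B)"
        using measurable_sets[OF S_meas sets.Int[OF Z B]] by (simp add: pred_def vimage_def)
      ultimately have "Measurable.pred gaps (\<lambda>y. s < y 0 \<and> ?S s y \<in> {A. 0 \<in> A} \<inter> B)"
        by measurable
      then show ?thesis by (simp add: pred_def)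
    qed
    have only_0: "emeasure gaps {y. s < y 0 \<and> ?S s y \<in> {A. 0 \<in> A} \<inter> B}
        = (if s = 0 then emeasure gaps (renewal_points -` B) else 0)" for s
    proof -
      have "AE y in gaps. y \<in> {y. s < y 0 \<and> ?S s y \<in> {A. 0 \<in> A} \<inter> B} \<longleftrightarrow>
          y \<in> (if s = 0 then renewal_points -` B else {})"
        using AE_gaps_pos
      proof eventually_elim
        case (elim y)
        then have enum: "enumerates (position y) (renewal_points y)"
          by (intro enumerates_renewal_points) simp
        have p0: "0 \<in> renewal_points y" by (rule enumerates_imp_biinfinite(1)[OF enum])
        have "int s \<notin> renewal_points y" if "0 < s" "s < y 0"
          using enumerates_consecutive(1)[OF enum, of 0 "int (y 0)"] position_Suc[of y 0] that
          by (simp add: position_0)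
        then show ?case using p0 elim by (auto simp: image_iff)
      qed
      moreover have "(if s = 0 then renewal_points -` B else {}) \<in> sets gaps"
        using measurable_sets[OF measurable_renewal_points B] by simp
      ultimately have "emeasure gaps {y. s < y 0 \<and> ?S s y \<in> {A. 0 \<in> A} \<inter> B}
          = emeasure gaps (if s = 0 then renewal_points -` B else {})"
        by (intro emeasure_eq_AE sets_s)
      then show ?thesis by simp
    qed
    show ?thesis
      unfolding emeasure_law[OF sets.Int[OF Z B]] only_0
      by (subst suminf_finite[of "{0}"]) auto
  qed
  have zero: "emeasure law {A. 0 \<in> A} = 1 / mean"
    using main[OF sets.top] gaps.emeasure_space_1 by simp
  then show "emeasure law {A. 0 \<in> A} \<noteq> 0"
    using mean_finite by (simp add: ennreal_divide_eq_0_iff)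
  show "uniform_measure law {A. 0 \<in> A} = distr gaps point_configs renewal_points"
  proof (rule measure_eqI)
    fix B assume "B \<in> sets (uniform_measure law {A. 0 \<in> A})"
    then have B: "B \<in> sets point_configs" by simp
    obtain m where m: "mean = ennreal m" "0 < m"
      using mean_pos mean_finite by (cases mean) (auto simp: less_le)
    have "emeasure (uniform_measure law {A. 0 \<in> A}) B
        = (emeasure gaps (renewal_points -` B) / mean) / (1 / mean)"
      using Z B by (simp add: emeasure_uniform_measure main zero)
    also have "\<dots> = emeasure gaps (renewal_points -` B)"
    proof -
      have "1 / mean = ennreal (1 / m)" using m divide_ennreal[of 1 m] by simp
      then show ?thesis
        using m by (simp add: gaps.emeasure_eq_measure divide_ennreal)
    qed
    finally show "emeasure (uniform_measure law {A. 0 \<in> A}) B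
        = emeasure (distr gaps point_configs renewal_points) B"
      using B by (simp add: emeasure_distr)
  qed simp
qed

lemma AE_law_biinfinite: "AE A in law. biinfinite A"
proof -
  have sets: "{A. \<not> biinfinite A} \<in> sets point_configs"
  proof -
    have "Measurable.pred point_configs (\<lambda>A. \<not> biinfinite A)" by measurable
    then show ?thesis by (simp add: pred_def)
  qed
  have "emeasure gaps {y. s < y 0 \<and> (\<lambda>i. i + - int s) ` renewal_points y \<in> {A. \<not> biinfinite A}} = 0"
    for s
  proof -
    have "AE y in gaps. \<not> (s < y 0 \<and> (\<lambda>i. i + - int s) ` renewal_points y \<in> {A. \<not> biinfinite A})"
      using AE_gaps_pos
    proof eventually_elim
      case (elim y)
      then have "biinfinite (renewal_points y)"
        by (intro enumerates_imp_biinfinite(2)[OF enumerates_renewal_points]) simp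
      then show ?case using biinfinite_shift[of "renewal_points y" "- int s"] by simp
    qed
    from emeasure_eq_0_AE[OF this] show ?thesis by simp
  qed
  then have "emeasure law {A. \<not> biinfinite A} = 0"
    unfolding emeasure_law[OF sets] by simp
  then show ?thesis by (subst AE_iff_measurable[OF _ refl]) (simp_all add: sets)
qed

lemma palm_gaps:
  "distr (uniform_measure law {A. 0 \<in> A}) (PiM UNIV (\<lambda>_. count_space UNIV)) (\<lambda>A n. gap n A)
    = PiM (UNIV :: int set) (\<lambda>_. measure_pmf G)"
proof -
  let ?P = "PiM (UNIV :: int set) (\<lambda>_. count_space (UNIV :: nat set))"
  have gap_meas: "(\<lambda>A n. gap n A) \<in> measurable point_configs ?P"
    by (rule measurable_PiM_single') (auto intro: measurable_gap)
  have "distr (uniform_measure law {A. 0 \<in> A}) ?P (\<lambda>A n. gap n A)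
      = distr gaps ?P (\<lambda>y n. gap n (renewal_points y))"
    unfolding palm_law by (subst distr_distr[OF gap_meas measurable_renewal_points]) (simp add: comp_def)
  also have "\<dots> = distr gaps gaps (\<lambda>y. y)"
  proof (rule distr_cong_AE)
    show "AE y in gaps. (\<lambda>n. gap n (renewal_points y)) = y"
      using AE_gaps_pos by eventually_elim (simp add: gap_renewal_points)
    show "(\<lambda>y n. gap n (renewal_points y)) \<in> measurable gaps ?P"
      by (rule measurable_compose[OF measurable_renewal_points gap_meas])
  qed (simp_all add: sets_gaps)
  also have "\<dots> = gaps" by (rule distr_id)
  finally show ?thesis by (simp add: gaps_def)
qed

lemma stationary_renewal_process_of_law:
  assumes "prob_space M" and [measurable]: "X \<in> measurable M point_configs"
    and X: "distr M point_configs X = law"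
  shows "stationary_renewal_process M G X"
proof (rule stationary_renewal_processI)
  have "emeasure M {\<omega> \<in> space M. 0 \<in> X \<omega>} = emeasure (distr M point_configs X) {A. 0 \<in> A}"
    using pred_mem_point_configs[of 0]
    by (subst emeasure_distr) (auto simp: pred_def vimage_def Int_def conj_commute)
  then show "emeasure M {\<omega> \<in> space M. 0 \<in> X \<omega>} \<noteq> 0" using law_zero X by simp
  show "AE A in distr M point_configs X. biinfinite A"
    unfolding X by (rule AE_law_biinfinite)
qed (simp_all add: assms law_shift palm_gaps)

lemma obstacle_field_exists:
  "\<exists>(M :: (nat \<Rightarrow> int set) measure) Q. obstacle_field M G Q"
proof -
  let ?M = "PiM (UNIV :: nat set) (\<lambda>_. law)"
  have prob: "prob_space ?M" by (intro prob_space_PiM prob_space_law)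
  interpret prob_space ?M by fact
  have meas: "(\<lambda>\<omega>. \<omega> j) \<in> measurable ?M point_configs" for j :: nat
    using measurable_component_singleton[of j UNIV "\<lambda>_. law"]
    unfolding measurable_cong_sets[OF refl sets_law] by simp
  have component: "distr ?M point_configs (\<lambda>\<omega>. \<omega> j) = law" for j
  proof -
    have "distr ?M point_configs (\<lambda>\<omega>. \<omega> j) = distr ?M law (\<lambda>\<omega>. \<omega> j)"
      by (rule distr_cong) auto
    also have "\<dots> = law" by (rule distr_PiM_component) (auto intro: prob_space_law)
    finally show ?thesis .
  qed
  have "indep_vars (\<lambda>_. point_configs) (\<lambda>j \<omega>. \<omega> j) (UNIV :: nat set)"
  proof (subst indep_vars_iff_distr_eq_PiM')
    have "distr ?M (PiM UNIV (\<lambda>_. point_configs)) (\<lambda>\<omega>. \<lambda>j\<in>UNIV. \<omega> j) = distr ?M ?M (\<lambda>\<omega>. \<omega>)"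
      unfolding restrict_UNIV by (intro distr_cong sets_PiM_cong) simp_all
    also have "\<dots> = ?M" by (rule distr_id)
    finally show "distr ?M (PiM UNIV (\<lambda>_. point_configs)) (\<lambda>\<omega>. \<lambda>j\<in>UNIV. \<omega> j)
        = PiM UNIV (\<lambda>j. distr ?M point_configs (\<lambda>\<omega>. \<omega> j))"
      by (simp add: component)
  qed (auto intro: meas)
  moreover have "stationary_renewal_process ?M G (\<lambda>\<omega>. \<omega> j)" for j
    by (rule stationary_renewal_process_of_law[OF prob meas component])
  ultimately show ?thesis
    unfolding obstacle_field_def
    by (intro exI[of _ ?M] exI[of _ "\<lambda>\<omega> i j. if i \<in> \<omega> j then 0 else 1"]
        exI[of _ "\<lambda>j \<omega>. \<omega> j"] conjI prob) auto
qed

end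

section \<open>The theorem\<close>

lemma obstacle_field_le1: "obstacle_field M G Q \<Longrightarrow> Q \<omega> i j \<le> 1"
proof -
  assume "obstacle_field M G Q"
  then obtain X :: "nat \<Rightarrow> 'a \<Rightarrow> int set"
    where "\<And>\<omega> i j. Q \<omega> i j = (if i \<in> X j \<omega> then 0 else 1)"
    unfolding obstacle_field_def by blast
  then show ?thesis by simp
qed

lemma obstacle_field_free:
  assumes "obstacle_field M G Q"
  shows "AE \<omega> in M. \<forall>j. \<exists>i. Q \<omega> i j = 0"
proof -
  obtain X where srp: "\<And>j. stationary_renewal_process M G (X j)"
    and Q: "\<And>\<omega> i j. Q \<omega> i j = (if i \<in> X j \<omega> then 0 else 1)"
    using assms unfolding obstacle_field_def by blast
  have "AE \<omega> in M. \<exists>i. Q \<omega> i j = 0" for j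
  proof -
    have "AE \<omega> in M. \<forall>m. (\<exists>i\<in>X j \<omega>. i < m) \<and> (\<exists>i\<in>X j \<omega>. m < i)"
      using srp[of j] by (simp add: stationary_renewal_process_def)
    then show ?thesis by eventually_elim (auto simp: Q)
  qed
  then show ?thesis unfolding AE_all_countable by blast
qed

theorem mainTheorem4:
  "(\<forall>G (M :: 'w measure) Q. gap_distribution G \<longrightarrow> obstacle_field M G Q \<longrightarrow>
      (AE \<omega> in M. \<not> (\<exists>w. stationary_solution (1/2) (Q \<omega>) w)) \<and>
      (AE \<omega> in M. \<forall>i. liminf (\<lambda>k. enat (interface (1/2) (Q \<omega>) k i)) = \<infinity>)) \<and>
   (\<exists>G. gap_distribution G \<and>
      (\<exists>(M :: (nat \<Rightarrow> int set) measure) Q. obstacle_field M G Q \<and>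
         (AE \<omega> in M. limsup (\<lambda>n. ereal (real (interface (1/2) (Q \<omega>) n 0) / real n)) = 0)) \<and>
      (\<forall>(M :: 'w measure) Q. obstacle_field M G Q \<longrightarrow>
         (AE \<omega> in M. limsup (\<lambda>n. ereal (real (interface (1/2) (Q \<omega>) n 0) / real n)) = 0)))"
proof (intro conjI allI impI)
  fix G and M :: "'w measure" and Q
  assume field: "obstacle_field M G Q"
  note le1 = obstacle_field_le1[OF field]
  have free: "AE \<omega> in M. \<forall>j. \<exists>i. Q \<omega> i j = 0"
    by (rule obstacle_field_free[OF field])
  show "AE \<omega> in M. \<not> (\<exists>w. stationary_solution (1/2) (Q \<omega>) w)"
    using free by eventually_elim (use no_stationary_solution le1 in blast)
  show "AE \<omega> in M. \<forall>i. liminf (\<lambda>k. enat (interface (1/2) (Q \<omega>) k i)) = \<infinity>"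
    using free
  proof eventually_elim
    case (elim \<omega>)
    have "\<exists>i. Q \<omega> i j = 0" for j using elim by blast
    then show ?case by (intro allI interface_liminf le1)
  qed
next
  interpret renewal_construction heavy_gap
    by unfold_locales (rule gap_distribution_heavy)
  obtain M :: "(nat \<Rightarrow> int set) measure" and Q where field: "obstacle_field M heavy_gap Q"
    using obstacle_field_exists by blast
  show "\<exists>G. gap_distribution G \<and>
      (\<exists>(M :: (nat \<Rightarrow> int set) measure) Q. obstacle_field M G Q \<and>
         (AE \<omega> in M. limsup (\<lambda>n. ereal (real (interface (1/2) (Q \<omega>) n 0) / real n)) = 0)) \<and>
      (\<forall>(M :: 'w measure) Q. obstacle_field M G Q \<longrightarrow>
         (AE \<omega> in M. limsup (\<lambda>n. ereal (real (interface (1/2) (Q \<omega>) n 0) / real n)) = 0))"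
    by (intro exI[of _ heavy_gap] exI[of _ M] exI[of _ Q] conjI allI impI
        gap_distribution_heavy field heavy_gap_zero_velocity)
qed

end
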